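(* Let $q$ be a prime power and let $t, k_1,\ldots,k_t,k,n_1,\ldots,n_t,n,m$ be positive integers with $1\le k_i<n_i\le m$ for each $i\in[t]:=\{1,\ldots,t\}$, $k=k_1+\ldots+k_t$ and $n=n_1+\ldots+n_t$. For each $i\in[t]$ let $\mathcal S_i\subseteq\mathbb F_{q^m}^{k_i}$ be an $[n_i,k_i]_{q^m/q}$ system such that $(\mathcal S_i,\rho_{\mathcal S_i})$ is an $\mathbb F_{q^m}$-representation of the uniform $q$-matroid $\mathcal U_{k_i,n_i}(q)$. Define the $[n,k]_{q^m/q}$ system $\mathcal S:=\bigoplus_{i=1}^t\mathcal S_i\subseteq \mathbb F_{q^m}^k$. For each $\mathcal J\subseteq[t]$ put $k_{\mathcal J}:=\sum_{j\in\mathcal J}k_j$ and $\mathcal S_{\mathcal J}:=\sum_{j\in\mathcal J}\iota_j(\mathcal S_j)$. Then the following statements are equivalent. (1) $(\mathcal S,\rho_{\mathcal S})$ is an $\mathbb F_{q^m}$-representation of $\mathcal U_{k_1,n_1}(q)\oplus\cdots\oplus\mathcal U_{k_t,n_t}(q)$. (2) For every $\mathbb F_q$-subspace $I\subseteq\mathcal S$ it holds that $$\rho_{\mathcal S}(I)=\dim_{\mathbb F_q}(I)\iff \dim_{\mathbb F_q}(I\cap\mathcal S_{\mathcal J})\le k_{\mathcal J}\ \text{ for all }\mathcal J\subseteq[t].$$ (3) $\mathcal S$ is $(\Lambda_{k-1,\mathbf k},k-1)$-evasive, where $\mathbf k=(k_1,\ldots,k_t)$.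
   Context: **Systems.** An $[n,k]_{q^m/q}$ system is an $n$-dimensional $\mathbb F_q$-subspace $\mathcal S$ of $\mathbb F_{q^m}^k$ with $\langle\mathcal S\rangle_{\mathbb F_{q^m}}=\mathbb F_{q^m}^k$. For an $\mathbb F_q$-subspace $V\subseteq \mathbb F_{q^m}^k$ put $\rho(V)=\dim_{\mathbb F_{q^m}}\langle V\rangle_{\mathbb F_{q^m}}$; its restriction to the $\mathbb F_q$-subspaces of $\mathcal S$ is denoted $\rho_{\mathcal S}$. With $\mathbb F_{q^m}^k=\mathbb F_{q^m}^{k_1}\oplus\cdots\oplus\mathbb F_{q^m}^{k_t}$, $\iota_i$ denotes the embedding of $\mathbb F_{q^m}^{k_i}$ as the $i$-th summand (zeros in all other blocks), and $\bigoplus_{i=1}^t\mathcal S_i:=\iota_1(\mathcal S_1)+\ldots+\iota_t(\mathcal S_t)$. **Evasiveness.** For a collection $\mathcal A$ of $\mathbb F_q$-subspaces of $\mathbb F_{q^m}^k$ and an integer $h\ge 0$, $\mathcal S$ is $(\mathcal A,h)$-evasive if $\dim_{\mathbb F_q}(\mathcal S\cap A)\le h$ for all $A\in\mathcal A$. For $0\le h\le k-1$ and $\mathbf k=(k_1,\ldots,k_t)$ with $k=k_1+\ldots+k_t$, $$\Lambda_{h,\mathbf k}:=\{V: V \text{ is an }\mathbb F_{q^m}\text{-subspace of }\mathbb F_{q^m}^k,\ \dim_{\mathbb F_{q^m}}(V)=h,\ \iota_i(\mathbb F_{q^m}^{k_i})\not\subseteq V\text{ for all } i\in[t]\}.$$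 **$q$-Matroids.** For a finite-dimensional $\mathbb F_q$-vector space $E$ let $\mathcal L(E)$ be the lattice of its subspaces. A $q$-matroid with ground space $E$ is a pair $(E,\rho)$ with $\rho:\mathcal L(E)\to\mathbb Z$ satisfying, for all $A,B\in\mathcal L(E)$: $0\le\rho(A)\le\dim A$; $A\le B\Rightarrow\rho(A)\le\rho(B)$; $\rho(A+B)+\rho(A\cap B)\le\rho(A)+\rho(B)$. Two $q$-matroids $(E_1,\rho_1),(E_2,\rho_2)$ are equivalent ($\cong$) if there is an $\mathbb F_q$-isomorphism $\alpha:E_1\to E_2$ with $\rho_1(V)=\rho_2(\alpha(V))$ for all $V\in\mathcal L(E_1)$. The uniform $q$-matroid $\mathcal U_{k,n}(q)$ is $(\mathbb F_q^n,\rho)$ with $\rho(V)=\min\{k,\dim V\}$. For an $[n,k]_{q^m/q}$ system $\mathcal S$, the pair $(\mathcal S,\rho_{\mathcal S})$ is a $q$-matroid; it is called an $\mathbb F_{q^m}$-representation of a $q$-matroid $\mathcal M$ if $\mathcal M\cong(\mathcal S,\rho_{\mathcal S})$. **Direct sum.** For $q$-matroids $\mathcal M_i=(E_i,\rho_i)$, $i=1,2$, let $E=E_1\oplus E_2$ with projections $\pi_i:E\to E_i$ and $\rho_i'(V)=\rho_i(\pi_i(V))$. Then $\mathcal M_1\oplus\mathcal M_2=(E,\rho)$ with $\rho(V)=\dim V+\min_{X\le V}(\rho_1'(X)+\rho_2'(X)-\dim X)$. For $t>2$, $\mathcal M_1\oplus\cdots\oplus\mathcal M_t:=(\mathcal M_1\oplus\cdots\oplus\mathcal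 M_{t-1})\oplus\mathcal M_t$. *)

theory Defs
  imports "HOL-Analysis.Product_Vector" "HOL-Library.Function_Algebras" "HOL-Library.Cardinality"
begin

text \<open>
  The fields \<open>F_q\<close> and \<open>F_{q^m}\<close> are two finite field types \<open>'f\<close> and \<open>'K\<close>, linked by an
  embedding \<open>emb\<close>.  Vectors over a field are functions on \<open>nat\<close>, and the space of row vectors of
  length \<open>n\<close> is the carrier \<open>vecs n\<close>.  Linear algebra (\<^const>\<open>module.subspace\<close>,
  \<^const>\<open>module.span\<close>, \<^const>\<open>vector_space.dim\<close>) is that of the library, taken with respect to
  an explicit scalar multiplication, so that \<open>F_q\<close>- and \<open>F_{q^m}\<close>-notions coexist on one type.
\<close>

definition field_embedding :: "('f::field \<Rightarrow> 'K::field) \<Rightarrow> bool" where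
  "field_embedding emb \<longleftrightarrow> emb 1 = 1 \<and> (\<forall>x y. emb (x + y) = emb x + emb y) \<and>
     (\<forall>x y. emb (x * y) = emb x * emb y)"

definition pointwise :: "('f \<Rightarrow> 'v \<Rightarrow> 'v) \<Rightarrow> 'f \<Rightarrow> (nat \<Rightarrow> 'v) \<Rightarrow> (nat \<Rightarrow> 'v)" where
  "pointwise s c v = (\<lambda>i. s c (v i))"

abbreviation fscale :: "'f::field \<Rightarrow> (nat \<Rightarrow> 'f) \<Rightarrow> (nat \<Rightarrow> 'f)" where
  "fscale \<equiv> pointwise (*)"

definition emb_mult :: "('f::field \<Rightarrow> 'K::field) \<Rightarrow> 'f \<Rightarrow> 'K \<Rightarrow> 'K" where
  "emb_mult emb c x = emb c * x"

abbreviation escale :: "('f::field \<Rightarrow> 'K::field) \<Rightarrow> 'f \<Rightarrow> (nat \<Rightarrow> 'K) \<Rightarrow> (nat \<Rightarrow> 'K)" where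
  "escale emb \<equiv> pointwise (emb_mult emb)"

definition vecs :: "nat \<Rightarrow> (nat \<Rightarrow> 'a::zero) set" where
  "vecs n = {v. \<forall>i\<ge>n. v i = 0}"

lemma vector_space_mult: "vector_space ((*) :: 'f::field \<Rightarrow> 'f \<Rightarrow> 'f)"
  by unfold_locales (simp_all add: algebra_simps)

lemma vector_space_emb: "field_embedding emb \<Longrightarrow> vector_space (emb_mult emb)"
  by unfold_locales (simp_all add: field_embedding_def emb_mult_def algebra_simps)

lemma vector_space_pointwise: "vector_space s \<Longrightarrow> vector_space (pointwise s)"
  by (simp add: vector_space_def pointwise_def fun_eq_iff)


section \<open>\<open>q\<close>-matroids\<close>

text \<open>
  A \<open>q\<close>-matroid is a pair of a ground space and a rank function.  Only the values of the rank
  function on subspaces of the ground space are meaningful.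
\<close>

type_synonym 'v qmat = "'v set \<times> ('v set \<Rightarrow> int)"

definition subspaces_of :: "('f::field \<Rightarrow> 'v::ab_group_add \<Rightarrow> 'v) \<Rightarrow> 'v set \<Rightarrow> 'v set set" where
  "subspaces_of s E = {V. module.subspace s V \<and> V \<subseteq> E}"

definition q_matroid :: "('f::field \<Rightarrow> 'v::ab_group_add \<Rightarrow> 'v) \<Rightarrow> 'v qmat \<Rightarrow> bool" where
  "q_matroid s M \<longleftrightarrow> (case M of (E, \<rho>) \<Rightarrow>
     (\<exists>B. finite B \<and> E = module.span s B) \<and>
     (\<forall>A\<in>subspaces_of s E. 0 \<le> \<rho> A \<and> \<rho> A \<le> int (vector_space.dim s A)) \<and>
     (\<forall>A\<in>subspaces_of s E. \<forall>B\<in>subspaces_of s E. A \<subseteq> B \<longrightarrow> \<rho> A \<le> \<rho> B) \<and>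
     (\<forall>A\<in>subspaces_of s E. \<forall>B\<in>subspaces_of s E.
        \<rho> {a + b |a b. a \<in> A \<and> b \<in> B} + \<rho> (A \<inter> B) \<le> \<rho> A + \<rho> B))"

text \<open>
  An isomorphism of the ground spaces is given as a linear map of the ambient types that restricts
  to a bijection; every linear map on a subspace extends to the ambient space.
\<close>

definition qm_equiv ::
    "('f::field \<Rightarrow> 'v::ab_group_add \<Rightarrow> 'v) \<Rightarrow> ('f \<Rightarrow> 'w::ab_group_add \<Rightarrow> 'w) \<Rightarrow> 'v qmat \<Rightarrow> 'w qmat \<Rightarrow> bool"
  where
  "qm_equiv s1 s2 M1 M2 \<longleftrightarrow> q_matroid s1 M1 \<and> q_matroid s2 M2 \<and>
     (\<exists>\<alpha>. Vector_Spaces.linear s1 s2 \<alpha> \<and> bij_betw \<alpha> (fst M1) (fst M2) \<and>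
        (\<forall>V\<in>subspaces_of s1 (fst M1). snd M1 V = snd M2 (\<alpha> ` V)))"

definition uniform_qm :: "nat \<Rightarrow> nat \<Rightarrow> (nat \<Rightarrow> 'f::field) qmat" where
  "uniform_qm k n = (vecs n, \<lambda>V. int (min k (vector_space.dim fscale V)))"

text \<open>
  The direct sum of two \<open>q\<close>-matroids lives on the product space.  Over a finite field a
  finite-dimensional space has finitely many subspaces, so \<^const>\<open>Min\<close> is taken over a finite set.
\<close>

definition qm_dsum ::
    "('f::field \<Rightarrow> 'v::ab_group_add \<Rightarrow> 'v) \<Rightarrow> ('f \<Rightarrow> 'w::ab_group_add \<Rightarrow> 'w) \<Rightarrow>
     'v qmat \<Rightarrow> 'w qmat \<Rightarrow> ('v \<times> 'w) qmat" where
  "qm_dsum s1 s2 M1 M2 =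
     (let s = module_prod.scale s1 s2 in
      (fst M1 \<times> fst M2,
       \<lambda>V. int (vector_space.dim s V) +
           Min ((\<lambda>X. snd M1 (fst ` X) + snd M2 (snd ` X) - int (vector_space.dim s X))
                  ` subspaces_of s V)))"

text \<open>Transport of structure along a map that is injective on the ground space.\<close>

definition qm_map :: "('v \<Rightarrow> 'w) \<Rightarrow> 'v qmat \<Rightarrow> 'w qmat" where
  "qm_map f M = (f ` fst M, \<lambda>V. snd M (f -` V \<inter> fst M))"

text \<open>
  The iterated direct sum \<open>(\<dots>(M 0 \<oplus> M 1) \<oplus> \<dots>) \<oplus> M r\<close> of \<open>r + 1\<close> factors.  To keep a single
  type, each binary direct sum is transported from pairs to sequences of vectors: a pair \<open>(w, x)\<close>,
  where \<open>w\<close> vanishes from position \<open>r + 1\<close> on, becomes \<open>w\<close> with \<open>x\<close> put at position \<open>r + 1\<close>.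
\<close>

primrec qm_dsums ::
    "('f::field \<Rightarrow> 'v::ab_group_add \<Rightarrow> 'v) \<Rightarrow> (nat \<Rightarrow> 'v qmat) \<Rightarrow> nat \<Rightarrow> (nat \<Rightarrow> 'v) qmat" where
  "qm_dsums s M 0 = qm_map (\<lambda>x. 0(0 := x)) (M 0)"
| "qm_dsums s M (Suc r) =
     qm_map (\<lambda>(w, x). w(Suc r := x)) (qm_dsum (pointwise s) s (qm_dsums s M r) (M (Suc r)))"


section \<open>Systems\<close>

definition is_system :: "('f::field \<Rightarrow> 'K::field) \<Rightarrow> nat \<Rightarrow> nat \<Rightarrow> (nat \<Rightarrow> 'K) set \<Rightarrow> bool" where
  "is_system emb n k S \<longleftrightarrow> module.subspace (escale emb) S \<and> S \<subseteq> vecs k \<and>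
     vector_space.dim (escale emb) S = n \<and> module.span fscale S = vecs k"

definition sys_rank :: "(nat \<Rightarrow> 'K::field) set \<Rightarrow> int" where
  "sys_rank V = int (vector_space.dim fscale (module.span fscale V))"

text \<open>
  The \<open>[n,k]\<close> system \<open>S\<close> with its rank function is an \<open>F_{q^m}\<close>-representation of the
  \<open>q\<close>-matroid \<open>M\<close>, whose ground space carries the scalar multiplication \<open>s\<close>.
\<close>

definition represents ::
    "('f::field \<Rightarrow> 'K::field) \<Rightarrow> nat \<Rightarrow> nat \<Rightarrow> (nat \<Rightarrow> 'K) set \<Rightarrow>
     ('f \<Rightarrow> 'v::ab_group_add \<Rightarrow> 'v) \<Rightarrow> 'v qmat \<Rightarrow> bool" where
  "represents emb n k S s M \<longleftrightarrow>
     is_system emb n k S \<and> qm_equiv s (escale emb) M (S, sys_rank)"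

text \<open>Blocks are numbered from \<open>0\<close>; block \<open>i\<close> starts at coordinate \<open>ks 0 + \<dots> + ks (i - 1)\<close>.\<close>

definition block_embed :: "(nat \<Rightarrow> nat) \<Rightarrow> nat \<Rightarrow> (nat \<Rightarrow> 'K::field) \<Rightarrow> (nat \<Rightarrow> 'K)" where
  "block_embed ks i v =
     (\<lambda>j. if sum ks {..<i} \<le> j \<and> j < sum ks {..<i} + ks i then v (j - sum ks {..<i}) else 0)"

definition block_sum ::
    "(nat \<Rightarrow> nat) \<Rightarrow> nat set \<Rightarrow> (nat \<Rightarrow> (nat \<Rightarrow> 'K::field) set) \<Rightarrow> (nat \<Rightarrow> 'K) set" where
  "block_sum ks J S = {\<Sum>j\<in>J. block_embed ks j (v j) |v. \<forall>j\<in>J. v j \<in> S j}"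

definition evasive ::
    "('f::field \<Rightarrow> 'K::field) \<Rightarrow> (nat \<Rightarrow> 'K) set set \<Rightarrow> nat \<Rightarrow> (nat \<Rightarrow> 'K) set \<Rightarrow> bool" where
  "evasive emb \<A> h S \<longleftrightarrow> (\<forall>A\<in>\<A>. vector_space.dim (escale emb) (S \<inter> A) \<le> h)"

definition Lambda :: "nat \<Rightarrow> nat \<Rightarrow> (nat \<Rightarrow> nat) \<Rightarrow> (nat \<Rightarrow> 'K::field) set set" where
  "Lambda h t ks = {V \<in> subspaces_of fscale (vecs (sum ks {..<t})). vector_space.dim fscale V = h \<and>
     (\<forall>i<t. \<not> block_embed ks i ` vecs (ks i) \<subseteq> V)}"

end

theory Submission
  imports Defs "HOL-Library.FuncSet"
begin

text \<open>
  Call an \<open>F_q\<close>-subspace \<open>I\<close> of \<open>Ssum\<close> block-bounded if \<open>dim (I \<inter> SJ J) \<le> k_J\<close> for every set \<open>J\<close> of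
  blocks.  Every subspace whose rank equals its dimension is block-bounded, since
  \<open>I \<inter> SJ J\<close> then has rank equal to its dimension and spans at most the \<open>k_J\<close>-dimensional sum of the
  blocks in \<open>J\<close>.  So \<open>P2\<close> asks for the converse.

  \<open>P1\<close> \<open>\<longleftrightarrow>\<close> \<open>P2\<close>.  By induction on the number of summands (\<open>qm_dsums_rank\<close>), a direct sum of
  \<open>q\<close>-matroids has the rank function
  \<open>\<rho> V = dim V + min_{X \<le> V} (\<Sum>_i \<rho>_i (\<pi>_i X) - dim X)\<close>.  For uniform summands, \<open>\<rho> V = dim V\<close> then means
  that \<open>V\<close> is block-bounded (\<open>uniform_sum_indep_iff\<close>): the inequality for \<open>X\<close> is tested
  on the blocks in which the projection of \<open>X\<close> has dimension at least \<open>k_i\<close>.  A \<open>q\<close>-matroid is determined by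
  its independent subspaces (\<open>rank_eq_if_same_indep\<close>), so \<open>P2\<close> gives \<open>P1\<close> along the
  isomorphism that respects the blocks.  An isomorphism witnessing \<open>P1\<close> need not respect the blocks.
  However, it forces \<open>Ssum\<close> to have as many independent as block-bounded subspaces, and since the former
  are among the latter, the two finite families agree (\<open>represents_iff\<close>).

  \<open>P2\<close> \<open>\<longrightarrow>\<close> \<open>P3\<close>.  Suppose a hyperplane \<open>H\<close> without full blocks meets \<open>Ssum\<close> in dimension at least \<open>k\<close>.
  Take a minimal nonempty \<open>J\<close> with \<open>dim (SJ J \<inter> H) \<ge> k_J\<close> and a subspace \<open>I\<close> of \<open>SJ J \<inter> H\<close> of dimension
  exactly \<open>k_J\<close>.  Minimality makes \<open>I\<close> block-bounded, so \<open>I\<close> spans all blocks of \<open>J\<close>, and these would lie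
  in \<open>H\<close> (\<open>evasive_if_block_bounded_indep\<close>).

  \<open>P3\<close> \<open>\<longrightarrow>\<close> \<open>P2\<close>.  A block-bounded subspace extends to a block-bounded \<open>I\<close> of dimension \<open>k\<close>
  (\<open>block_bounded_extend\<close>); it suffices that \<open>I\<close> has rank \<open>k\<close>.  Otherwise a nonzero
  \<open>F_{q^m}\<close>-functional \<open>\<phi>\<close> vanishes on \<open>I\<close>.  Let \<open>D\<close> be the set of blocks on which \<open>\<phi>\<close> vanishes.  Its
  kernel contains \<open>I + SJ D\<close>, whence \<open>dim \<phi>(Ssum) \<le> n - k - n_D + k_D\<close>.  The functional can be repaired
  one block of \<open>D\<close> at a time: add a multiple of a functional \<open>\<psi>\<close> on that block whose kernel meets \<open>S i\<close> in
  dimension at least \<open>k_i - 1\<close>, the multiple being chosen such that its image shares a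
  nonzero value with that of \<open>\<phi>\<close>; this saves one dimension and preserves the bound (\<open>functional_image_dim\<close>).
  In the end the kernel is a hyperplane that contains no block and meets \<open>Ssum\<close> in dimension at least \<open>k\<close>.

  Finite subspaces over a field with \<open>q\<close> elements satisfy \<open>card V = q ^ dim V\<close>, so the dimension formulas for
  subspaces of the infinite-dimensional ambient types are obtained by counting.
\<close>

section \<open>Finite subspaces over a finite field\<close>

text \<open>
  The fibres of an additive map are cosets of its kernel.  Stated for plain groups, this one count yields both
  the rank-nullity theorem (apply it to a linear map) and the modular law (apply it to addition on \<open>A \<times> B\<close>).
\<close>

lemma card_additive_image:
  fixes f :: "'a::ab_group_add \<Rightarrow> 'b::ab_group_add"
  assumes "finite V" and diff: "\<And>x y. x \<in> V \<Longrightarrow> y \<in> V \<Longrightarrow> x - y \<in> V"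
    and f: "\<And>x y. x \<in> V \<Longrightarrow> y \<in> V \<Longrightarrow> f (x - y) = f x - f y"
  shows "card V = card {x \<in> V. f x = 0} * card (f ` V)"
proof -
  have fib: "card {x \<in> V. f x = y} = card {x \<in> V. f x = 0}" if y: "y \<in> f ` V" for y
  proof -
    from y obtain a where a: "a \<in> V" "y = f a" by auto
    have z: "0 \<in> V" using diff[OF a(1) a(1)] by simp
    have pl: "x + a \<in> V" if "x \<in> V" for x
    proof -
      have "- a \<in> V" using diff[OF z a(1)] by simp
      from diff[OF that this] show ?thesis by simp
    qed
    have fp: "f (x + a) = f x + f a" if "x \<in> V" for x
      using f[OF pl[OF that] a(1)] by simp
    have "bij_betw (\<lambda>x. x + a) {x \<in> V. f x = 0} {x \<in> V. f x = y}"
    proof (rule bij_betw_byWitness[where f' = "\<lambda>x. x - a"])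
      show "(\<lambda>x. x + a) ` {x \<in> V. f x = 0} \<subseteq> {x \<in> V. f x = y}"
        using pl fp a by auto
      show "(\<lambda>x. x - a) ` {x \<in> V. f x = y} \<subseteq> {x \<in> V. f x = 0}"
        using diff f a by auto
    qed auto
    then show ?thesis by (simp add: bij_betw_same_card)
  qed
  have "V = (\<Union>y\<in>f ` V. {x \<in> V. f x = y})" by auto
  then have "card V = card (\<Union>y\<in>f ` V. {x \<in> V. f x = y})" by simp
  also have "\<dots> = (\<Sum>y\<in>f ` V. card {x \<in> V. f x = y})"
    using \<open>finite V\<close> by (intro card_UN_disjoint) auto
  also have "\<dots> = card {x \<in> V. f x = 0} * card (f ` V)"
    using fib by simp
  finally show ?thesis .
qed

lemma one_less_CARD_field: "1 < CARD('f::{field,finite})"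
proof -
  have "card {0, 1 :: 'f} \<le> CARD('f)" by (intro card_mono) auto
  then show ?thesis by simp
qed

text \<open>
  The scalar multiplication is a locale parameter because one vector is read over both fields; the ambient
  space may be infinite-dimensional, and finiteness is assumed only of the subspaces at hand.
\<close>

locale finite_scalars = vector_space scale
  for scale :: "'f::{field,finite} \<Rightarrow> 'v::ab_group_add \<Rightarrow> 'v"
begin

lemma card_span_independent:
  assumes "finite B" "independent B"
  shows "finite (span B) \<and> card (span B) = CARD('f) ^ card B"
  using assms
proof (induction B)
  case (insert b B)
  have ni: "b \<notin> span B" and iB: "independent B"
    using insert by (auto simp: independent_insert)
  have fin: "finite (span B)" and card: "card (span B) = CARD('f) ^ card B"
    using insert.IH iB by auto
  have eq: "span (insert b B) = (\<lambda>(c, x). scale c b + x) ` (UNIV \<times> span B)"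
  proof (intro equalityI subsetI)
    fix x assume "x \<in> span (insert b B)"
    then obtain c where "x - scale c b \<in> span B" by (auto simp: span_breakdown_eq)
    then show "x \<in> (\<lambda>(c, x). scale c b + x) ` (UNIV \<times> span B)"
      by (intro image_eqI[of _ _ "(c, x - scale c b)"]) auto
  next
    fix x assume "x \<in> (\<lambda>(c, x). scale c b + x) ` (UNIV \<times> span B)"
    then obtain c y where "x = scale c b + y" "y \<in> span B" by auto
    then show "x \<in> span (insert b B)"
      unfolding span_breakdown_eq by (intro exI[of _ c]) simp
  qed
  have inj: "inj_on (\<lambda>(c, x). scale c b + x) (UNIV \<times> span B)"
  proof (rule inj_onI, clarsimp)
    fix c x d y assume x: "x \<in> span B" and y: "y \<in> span B"
      and e: "scale c b + x = scale d b + y"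
    have "scale (c - d) b = y - x" using e by (simp add: algebra_simps)
    then have sp: "scale (c - d) b \<in> span B" using x y by (simp add: span_diff)
    have "c = d"
    proof (rule ccontr)
      assume "c \<noteq> d"
      then have "b = scale (inverse (c - d)) (scale (c - d) b)" by simp
      also have "\<dots> \<in> span B" by (rule span_scale[OF sp])
      finally show False using ni by simp
    qed
    then show "c = d \<and> x = y" using e by simp
  qed
  show ?case using fin card insert.hyps
    unfolding eq by (simp add: card_image[OF inj] card_cartesian_product)
qed simp

lemma card_subspace:
  assumes "subspace V" "finite V"
  shows "card V = CARD('f) ^ dim V"
proof -
  obtain B where B: "B \<subseteq> V" "independent B" "V \<subseteq> span B" "card B = dim V"
    using basis_exists by blast
  have "span B = V" using B assms by (intro span_subspace) auto
  then show ?thesis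
    using card_span_independent[of B] B finite_subset[OF B(1) assms(2)] by auto
qed

lemma dim_eqI: "subspace V \<Longrightarrow> finite V \<Longrightarrow> card V = CARD('f) ^ d \<Longrightarrow> dim V = d"
  using card_subspace[of V] one_less_CARD_field[where 'f = 'f] by (auto simp: power_inject_exp)

lemma dim_mono_subspace:
  assumes "subspace V" "subspace W" "finite W" "V \<subseteq> W"
  shows "dim V \<le> dim W"
proof -
  have "CARD('f) ^ dim V \<le> CARD('f) ^ dim W"
    using card_subspace[of V] card_subspace[of W] assms card_mono[of W V] finite_subset[of V W]
    by auto
  then show ?thesis using one_less_CARD_field[where 'f = 'f] by (simp add: power_increasing_iff)
qed

lemma dim_eq_imp_eq:
  assumes "subspace V" "subspace W" "finite W" "V \<subseteq> W" "dim W \<le> dim V"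
  shows "V = W"
proof -
  have "dim V = dim W" using dim_mono_subspace[OF assms(1-4)] assms(5) by simp
  then have "card V = card W"
    using card_subspace[of V] card_subspace[of W] assms finite_subset[of V W] by auto
  then show ?thesis using assms by (intro card_subset_eq) auto
qed

lemma dim_zero_space [simp]: "dim {0} = 0"
  by (rule dim_eqI) auto

lemma dim_eq_0_imp: "subspace V \<Longrightarrow> finite V \<Longrightarrow> dim V = 0 \<Longrightarrow> V = {0}"
  using dim_eq_imp_eq[of "{0}" V] subspace_0[of V] by auto

text \<open>
  The kernel of addition on \<open>A \<times> B\<close> is the antidiagonal copy of \<open>A \<inter> B\<close>.
\<close>

lemma dim_sum_Int:
  assumes A: "subspace A" "finite A" and B: "subspace B" "finite B"
  shows "dim {a + b |a b. a \<in> A \<and> b \<in> B} + dim (A \<inter> B) = dim A + dim B"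
proof -
  let ?S = "{a + b |a b. a \<in> A \<and> b \<in> B}"
  have S: "?S = (\<lambda>(a, b). a + b) ` (A \<times> B)" by auto
  have fS: "finite ?S" unfolding S using A B by simp
  have sS: "subspace ?S" by (rule subspace_sums[OF A(1) B(1)])
  have sI: "subspace (A \<inter> B)" by (rule subspace_inter[OF A(1) B(1)])
  have "card (A \<times> B) = card {x \<in> A \<times> B. (\<lambda>(a, b). a + b) x = 0} * card ((\<lambda>(a, b). a + b) ` (A \<times> B))"
    using A B by (intro card_additive_image) (auto simp: subspace_diff)
  also have "card {x \<in> A \<times> B. (\<lambda>(a, b). a + b) x = 0} = card (A \<inter> B)"
  proof -
    have "bij_betw (\<lambda>x. (x, - x)) (A \<inter> B) {x \<in> A \<times> B. (\<lambda>(a, b). a + b) x = 0}"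
    proof (rule bij_betw_byWitness[where f' = fst])
      show "fst ` {x \<in> A \<times> B. (\<lambda>(a, b). a + b) x = 0} \<subseteq> A \<inter> B"
      proof
        fix x assume "x \<in> fst ` {x \<in> A \<times> B. (\<lambda>(a, b). a + b) x = 0}"
        then obtain b where ab: "x \<in> A" "b \<in> B" "x + b = 0" by auto
        then have "x = - b" by (simp add: eq_neg_iff_add_eq_0)
        then show "x \<in> A \<inter> B" using ab B by (simp add: subspace_neg)
      qed
    qed (use A B in \<open>auto simp: subspace_neg minus_unique\<close>)
    then show ?thesis by (simp add: bij_betw_same_card)
  qed
  finally have "card A * card B = card (A \<inter> B) * card ?S"
    by (simp add: S card_cartesian_product)
  then have "CARD('f) ^ (dim A + dim B) = CARD('f) ^ (dim ?S + dim (A \<inter> B))"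
    using card_subspace[OF A] card_subspace[OF B] card_subspace[OF sS fS] card_subspace[OF sI] A(2)
    by (simp add: power_add mult.commute)
  then show ?thesis using one_less_CARD_field[where 'f = 'f] by (simp add: power_inject_exp)
qed

lemma finite_span_insert: "subspace V \<Longrightarrow> finite V \<Longrightarrow> finite (span (insert x V))"
proof -
  assume V: "subspace V" "finite V"
  have "span (insert x V) = {a + b |a b. a \<in> span {x} \<and> b \<in> V}"
    using span_Un[of "{x}" V] V(1) by (simp only: insert_is_Un[of x V] span_eq_iff[THEN iffD2])
  also have "\<dots> = (\<lambda>(a, b). a + b) ` (span {x} \<times> V)" by auto
  finally show ?thesis using V(2) by (simp only: span_singleton finite_imageI finite_cartesian_product finite)
qed

lemma dim_span_insert:
  assumes V: "subspace V" "finite V" and x: "x \<notin> V"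
  shows "dim (span (insert x V)) = Suc (dim V)"
proof -
  obtain B where B: "B \<subseteq> V" "independent B" "V \<subseteq> span B" "card B = dim V"
    using basis_exists by blast
  have sB: "span B = V" using B V by (intro span_subspace) auto
  have "span (insert x V) = span (insert x B)"
    unfolding span_eq using B sB span_superset[of "insert x B"] span_mono[of B "insert x B"] span_superset[of "insert x V"]
    by blast
  moreover have "independent (insert x B)"
    using B sB x by (intro independent_insertI) auto
  moreover have "card (insert x B) = Suc (dim V)"
    using B x finite_subset[OF B(1) V(2)] by (subst card_insert_disjoint) auto
  ultimately show ?thesis by (simp add: dim_eq_card_independent)
qed

lemma exists_subspace_of_dim:
  assumes "subspace V" "finite V" "d \<le> dim V"
  shows "\<exists>W. subspace W \<and> W \<subseteq> V \<and> dim W = d"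
proof -
  obtain B where B: "B \<subseteq> V" "independent B" "V \<subseteq> span B" "card B = dim V"
    using basis_exists by blast
  obtain C where C: "C \<subseteq> B" "card C = d"
    using B assms obtain_subset_with_card_n[of d B] by metis
  have "independent C" using B C independent_mono by blast
  moreover have "span C \<subseteq> V" using B C assms by (intro span_minimal) auto
  ultimately show ?thesis using C
    by (intro exI[of _ "span C"]) (auto simp: dim_eq_card_independent)
qed

lemma subspaces_of_iff: "V \<in> subspaces_of scale E \<longleftrightarrow> subspace V \<and> V \<subseteq> E"
  by (simp add: subspaces_of_def)

lemma finite_subspaces_of: "finite V \<Longrightarrow> finite (subspaces_of scale V)"
  by (rule finite_subset[of _ "Pow V"]) (auto simp: subspaces_of_def)

end

lemma dim_kernel_image:
  fixes s1 :: "'f::{field,finite} \<Rightarrow> 'v::ab_group_add \<Rightarrow> 'v"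
    and s2 :: "'f \<Rightarrow> 'w::ab_group_add \<Rightarrow> 'w"
  assumes f: "Vector_Spaces.linear s1 s2 f" and V: "module.subspace s1 V" "finite V"
  shows "vector_space.dim s1 V = vector_space.dim s1 {x \<in> V. f x = 0} + vector_space.dim s2 (f ` V)"
proof -
  interpret a: finite_scalars s1 using f by (simp add: finite_scalars_def Vector_Spaces.linear_def)
  interpret b: finite_scalars s2 using f by (simp add: finite_scalars_def Vector_Spaces.linear_def)
  interpret f: Vector_Spaces.linear s1 s2 f by (rule f)
  have s: "a.subspace {x \<in> V. f x = 0}"
    using a.subspace_inter[OF V(1) f.subspace_kernel] by (simp add: Int_def)
  have i: "b.subspace (f ` V)" by (rule f.subspace_image[OF V(1)])
  have "card V = card {x \<in> V. f x = 0} * card (f ` V)"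
    using V by (intro card_additive_image) (auto simp: a.subspace_diff f.diff)
  then have "CARD('f) ^ a.dim V = CARD('f) ^ (a.dim {x \<in> V. f x = 0} + b.dim (f ` V))"
    using a.card_subspace[OF V] a.card_subspace[OF s] b.card_subspace[OF i] V
    by (simp add: power_add)
  then show ?thesis using one_less_CARD_field[where 'f = 'f] by (simp add: power_inject_exp)
qed

lemma dim_image_inj_on:
  fixes s1 :: "'f::{field,finite} \<Rightarrow> 'v::ab_group_add \<Rightarrow> 'v"
    and s2 :: "'f \<Rightarrow> 'w::ab_group_add \<Rightarrow> 'w"
  assumes f: "Vector_Spaces.linear s1 s2 f" and V: "module.subspace s1 V" "finite V" "inj_on f V"
  shows "vector_space.dim s2 (f ` V) = vector_space.dim s1 V"
proof -
  interpret a: finite_scalars s1 using f by (simp add: finite_scalars_def Vector_Spaces.linear_def)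
  interpret f: Vector_Spaces.linear s1 s2 f by (rule f)
  have "{x \<in> V. f x = 0} = {0}"
    using V a.subspace_0[OF V(1)] f.zero by (auto dest: inj_onD[of f V _ 0])
  then show ?thesis using dim_kernel_image[OF f V(1,2)] by simp
qed

section \<open>Rank functions of \<open>q\<close>-matroids\<close>

context finite_scalars
begin

text \<open>
  Arguments about submodular rank functions adjoin one vector at a time; this is the corresponding
  induction along a chain from \<open>X\<close> up to \<open>V\<close>.
\<close>

lemma subspace_growth_induct [consumes 4, case_names base step]:
  assumes "subspace X" "subspace V" "finite V" "X \<subseteq> V"
    and base: "P X"
    and step: "\<And>W x. subspace W \<Longrightarrow> X \<subseteq> W \<Longrightarrow> W \<subseteq> V \<Longrightarrow> P W \<Longrightarrow> x \<in> V \<Longrightarrow> x \<notin> W \<Longrightarrow>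
                 P (span (insert x W))"
  shows "P V"
proof -
  have "P V" if "subspace W" "X \<subseteq> W" "W \<subseteq> V" "P W" for W
    using that
  proof (induction "dim V - dim W" arbitrary: W rule: less_induct)
    case less
    show ?case
    proof (cases "W = V")
      case False
      then obtain x where x: "x \<in> V" "x \<notin> W" using less.prems by auto
      let ?W = "span (insert x W)"
      have sub: "?W \<subseteq> V" using x less.prems assms by (intro span_minimal) auto
      have dW: "dim ?W = Suc (dim W)"
        using x less.prems assms(3) finite_subset by (intro dim_span_insert) auto
      have "dim ?W \<le> dim V"
        using sub assms by (intro dim_mono_subspace) auto
      then have "dim V - dim ?W < dim V - dim W" using dW by simp
      moreover have "X \<subseteq> ?W" using less.prems span_superset[of "insert x W"] by auto
      moreover have "P ?W" using less.prems x by (intro step) auto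
      ultimately show ?thesis using sub less.hyps[of ?W] by auto
    qed (use less in simp)
  qed
  then show ?thesis using assms by blast
qed

lemma span_insert_sum:
  assumes "subspace W"
  shows "span (insert x W) = {a + b |a b. a \<in> W \<and> b \<in> span {x}}"
  using span_Un[of W "{x}"] assms by (simp only: Un_insert_right Un_empty_right span_eq_iff[THEN iffD2])

context
  fixes E :: "'v set" and \<rho> :: "'v set \<Rightarrow> int"
  assumes Q: "q_matroid scale (E, \<rho>)" and fin: "finite E"
begin

lemma qm_ground: "subspace E"
  using Q by (auto simp: q_matroid_def)

lemma qm_bounds: "subspace A \<Longrightarrow> A \<subseteq> E \<Longrightarrow> 0 \<le> \<rho> A \<and> \<rho> A \<le> int (dim A)"
  using Q by (auto simp: q_matroid_def subspaces_of_def)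

lemma qm_mono: "subspace A \<Longrightarrow> subspace B \<Longrightarrow> A \<subseteq> B \<Longrightarrow> B \<subseteq> E \<Longrightarrow> \<rho> A \<le> \<rho> B"
  using Q by (auto simp: q_matroid_def subspaces_of_def)

lemma qm_submod: "subspace A \<Longrightarrow> A \<subseteq> E \<Longrightarrow> subspace B \<Longrightarrow> B \<subseteq> E \<Longrightarrow>
    \<rho> {a + b |a b. a \<in> A \<and> b \<in> B} + \<rho> (A \<inter> B) \<le> \<rho> A + \<rho> B"
  using Q by (auto simp: q_matroid_def subspaces_of_def)

text \<open>
  Adjoining a vector \<open>x\<close> raises the rank by at most the rank of the line spanned by \<open>x\<close>, by submodularity.
\<close>

lemma qm_unit_increase:
  assumes "subspace X" "subspace V" "X \<subseteq> V" "V \<subseteq> E"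
  shows "\<rho> V + int (dim X) \<le> \<rho> X + int (dim V)"
proof -
  have fV: "finite V" using assms fin finite_subset by blast
  show ?thesis using assms(1,2) fV assms(3)
  proof (induction rule: subspace_growth_induct)
    case (step W x)
    have WE: "W \<subseteq> E" and xE: "x \<in> E" using step assms by auto
    have sx: "span {x} \<subseteq> E" using xE qm_ground by (intro span_minimal) auto
    have "\<rho> (span (insert x W)) + \<rho> (W \<inter> span {x}) \<le> \<rho> W + \<rho> (span {x})"
      unfolding span_insert_sum[OF step.hyps(1)] using step WE sx by (intro qm_submod) auto
    moreover have "0 \<le> \<rho> (W \<inter> span {x})"
      using qm_bounds[of "W \<inter> span {x}"] step.hyps(1) WE by (auto simp: subspace_inter)
    moreover have "\<rho> (span {x}) \<le> 1"
      using qm_bounds[of "span {x}"] sx dim_le_card[of "span {x}" "{x}"] by auto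
    moreover have "dim (span (insert x W)) = Suc (dim W)"
      using step WE fin finite_subset by (intro dim_span_insert) auto
    ultimately show ?case using step.IH by simp
  qed simp
qed

lemma qm_indep_subspace:
  assumes "subspace X" "subspace V" "X \<subseteq> V" "V \<subseteq> E" "\<rho> V = int (dim V)"
  shows "\<rho> X = int (dim X)"
  using qm_unit_increase[OF assms(1-4)] qm_bounds[of X] assms by force

text \<open>Enlarging a maximal independent subspace by a vector cannot raise the rank, and by
  submodularity neither can doing so repeatedly.\<close>

lemma qm_exists_basis:
  assumes V: "subspace V" "V \<subseteq> E"
  shows "\<exists>I. subspace I \<and> I \<subseteq> V \<and> \<rho> I = int (dim I) \<and> \<rho> V = int (dim I)"
proof -
  have fV: "finite V" using assms fin finite_subset by blast
  let ?P = "\<lambda>I. subspace I \<and> I \<subseteq> V \<and> \<rho> I = int (dim I)"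
  have "?P {0}" using qm_bounds[of "{0}"] V subspace_0[OF V(1)] by auto
  moreover have "\<forall>I. ?P I \<longrightarrow> dim I < Suc (dim V)"
    using V fV by (auto simp: less_Suc_eq_le intro: dim_mono_subspace)
  ultimately have "\<exists>I. ?P I \<and> (\<forall>J. ?P J \<longrightarrow> dim J \<le> dim I)"
    by (rule Lattices_Big.ex_has_greatest_nat)
  then obtain I where I: "?P I" and max: "\<And>J. ?P J \<Longrightarrow> dim J \<le> dim I"
    by auto
  have "\<rho> V = \<rho> I" using I[THEN conjunct1] V(1) fV I[THEN conjunct2, THEN conjunct1]
  proof (induction rule: subspace_growth_induct)
    case (step W x)
    let ?J = "span (insert x I)"
    have WE: "W \<subseteq> E" and xE: "x \<in> E" and IE: "I \<subseteq> E" using step assms I by auto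
    have JV: "?J \<subseteq> V" using step V I by (intro span_minimal) auto
    have xI: "x \<notin> I" using step by auto
    have dJ: "dim ?J = Suc (dim I)"
      using I xI IE fin finite_subset by (intro dim_span_insert) auto
    have "\<rho> ?J \<noteq> int (dim ?J)" using max[of ?J] JV dJ by auto
    moreover have JE: "?J \<subseteq> E" using JV V by blast
    ultimately have J: "\<rho> ?J \<le> \<rho> I" using qm_bounds[OF subspace_span JE] dJ I by auto
    have Wx: "W \<union> insert x I = insert x W" using step.hyps(2) by auto
    have "span (insert x W) = {a + b |a b. a \<in> W \<and> b \<in> ?J}"
      using span_Un[of W "insert x I"] step.hyps(1,2)
      unfolding Wx by (simp only: span_eq_iff[THEN iffD2])
    then have "\<rho> (span (insert x W)) + \<rho> (W \<inter> ?J) \<le> \<rho> W + \<rho> ?J"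
      using qm_submod[of W ?J] step.hyps(1) WE JV V by auto
    moreover have "\<rho> I \<le> \<rho> (W \<inter> ?J)"
      using I step.hyps(1,2) WE span_superset[of "insert x I"] by (intro qm_mono) (auto simp: subspace_inter)
    moreover have "\<rho> W \<le> \<rho> (span (insert x W))"
    proof (rule qm_mono)
      show "span (insert x W) \<subseteq> E" using WE xE qm_ground by (intro span_minimal) auto
    qed (use step.hyps(1) span_superset[of "insert x W"] in auto)
    ultimately show ?case using step.IH J by simp
  qed simp
  then show ?thesis using I by metis
qed

end

text \<open>
  The rank function that a monotone submodular \<open>f\<close> induces.  With \<open>f\<close> the sum of the ranks of the projections
  it is the rank function of a direct sum.
\<close>

definition free_rank :: "('v set \<Rightarrow> int) \<Rightarrow> 'v set \<Rightarrow> int" where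
  "free_rank f V = int (dim V) + Min ((\<lambda>X. f X - int (dim X)) ` subspaces_of scale V)"

lemma free_rank_le:
  assumes "finite V" "subspace X" "X \<subseteq> V"
  shows "free_rank f V \<le> int (dim V) + f X - int (dim X)"
proof -
  have "Min ((\<lambda>X. f X - int (dim X)) ` subspaces_of scale V) \<le> f X - int (dim X)"
    using assms by (intro Min_le) (auto simp: finite_subspaces_of subspaces_of_iff)
  then show ?thesis by (simp add: free_rank_def)
qed

lemma free_rank_attained:
  assumes "finite V" "subspace V"
  obtains X where "subspace X" "X \<subseteq> V" "free_rank f V = int (dim V) + f X - int (dim X)"
proof -
  let ?A = "(\<lambda>X. f X - int (dim X)) ` subspaces_of scale V"
  have "Min ?A \<in> ?A" using assms
    by (intro Min_in) (auto simp: finite_subspaces_of subspaces_of_iff)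
  then obtain X where "subspace X" "X \<subseteq> V" "Min ?A = f X - int (dim X)"
    by (auto simp: subspaces_of_iff)
  then show thesis by (intro that[of X]) (auto simp: free_rank_def)
qed

lemma free_rank_eqI:
  assumes "finite V" "subspace V" "\<exists>X. subspace X \<and> X \<subseteq> V \<and> int (dim V) + f X - int (dim X) \<le> c"
    and "\<And>X. subspace X \<Longrightarrow> X \<subseteq> V \<Longrightarrow> c \<le> int (dim V) + f X - int (dim X)"
  shows "free_rank f V = c"
proof -
  obtain X where "subspace X" "X \<subseteq> V" "free_rank f V = int (dim V) + f X - int (dim X)"
    using free_rank_attained[OF assms(1,2), of f] by blast
  moreover obtain Y where "subspace Y" "Y \<subseteq> V" "int (dim V) + f Y - int (dim Y) \<le> c"
    using assms(3) by blast
  ultimately show ?thesis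
    using assms(4)[of X] free_rank_le[OF assms(1), of Y f] by force
qed

lemma free_rank_indep_iff:
  assumes "finite V" "subspace V" "f {0} = 0"
  shows "free_rank f V = int (dim V) \<longleftrightarrow> (\<forall>X. subspace X \<and> X \<subseteq> V \<longrightarrow> int (dim X) \<le> f X)"
proof
  assume L: "free_rank f V = int (dim V)"
  show "\<forall>X. subspace X \<and> X \<subseteq> V \<longrightarrow> int (dim X) \<le> f X"
    using free_rank_le[OF assms(1), of _ f] L by force
next
  assume R: "\<forall>X. subspace X \<and> X \<subseteq> V \<longrightarrow> int (dim X) \<le> f X"
  show "free_rank f V = int (dim V)"
  proof (rule free_rank_eqI[OF assms(1,2)])
    show "\<exists>X. subspace X \<and> X \<subseteq> V \<and> int (dim V) + f X - int (dim X) \<le> int (dim V)"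
      using assms subspace_0[OF assms(2)] by (intro exI[of _ "{0}"]) auto
  qed (use R in auto)
qed

text \<open>
  For monotonicity, a minimizer \<open>X\<close> for \<open>B\<close> is cut down to \<open>X \<inter> A\<close>.  For submodularity, minimizers \<open>X\<close> for \<open>A\<close>
  and \<open>Y\<close> for \<open>B\<close> give the candidates \<open>X + Y\<close> for \<open>A + B\<close> and \<open>X \<inter> Y\<close> for \<open>A \<inter> B\<close>; the inequality is
  then that for \<open>f\<close>, because dimensions are modular.
\<close>

lemma q_matroid_free_rank:
  assumes E: "subspace E" "finite E" and f0: "f {0} = 0"
    and mono: "\<And>A B. subspace A \<Longrightarrow> subspace B \<Longrightarrow> A \<subseteq> B \<Longrightarrow> B \<subseteq> E \<Longrightarrow> f A \<le> f B"
    and submod: "\<And>A B. subspace A \<Longrightarrow> A \<subseteq> E \<Longrightarrow> subspace B \<Longrightarrow> B \<subseteq> E \<Longrightarrow>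
       f {a + b |a b. a \<in> A \<and> b \<in> B} + f (A \<inter> B) \<le> f A + f B"
  shows "q_matroid scale (E, free_rank f)"
proof -
  have fin: "finite A" if "A \<subseteq> E" for A using that E finite_subset by blast
  have dm: "int (dim A) \<le> int (dim B)" if "subspace A" "subspace B" "A \<subseteq> B" "B \<subseteq> E" for A B
    using dim_mono_subspace[of A B] fin that by auto
  have "0 \<le> free_rank f A" and "free_rank f A \<le> int (dim A)" if A: "subspace A" "A \<subseteq> E" for A
  proof -
    obtain X where X: "subspace X" "X \<subseteq> A" "free_rank f A = int (dim A) + f X - int (dim X)"
      using free_rank_attained[OF fin[OF A(2)] A(1), of f] by blast
    have "f {0} \<le> f X" using X A subspace_0[OF X(1)] by (intro mono) auto
    then show "0 \<le> free_rank f A" using X(3) f0 dm[OF X(1) A(1) X(2) A(2)] by simp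
    show "free_rank f A \<le> int (dim A)"
      using free_rank_le[OF fin[OF A(2)], of "{0}" f] f0 subspace_0[OF A(1)] by simp
  qed
  moreover have "free_rank f A \<le> free_rank f B"
    if A: "subspace A" and B: "subspace B" and AB: "A \<subseteq> B" "B \<subseteq> E" for A B
  proof -
    obtain X where X: "subspace X" "X \<subseteq> B" "free_rank f B = int (dim B) + f X - int (dim X)"
      using free_rank_attained[OF fin[OF AB(2)] B, of f] by blast
    have sXA: "subspace (X \<inter> A)" by (rule subspace_inter[OF X(1) A])
    have "free_rank f A \<le> int (dim A) + f (X \<inter> A) - int (dim (X \<inter> A))"
      using fin[of A] AB sXA by (intro free_rank_le) auto
    also have "f (X \<inter> A) \<le> f X" using X sXA AB by (intro mono) auto
    finally have 1: "free_rank f A \<le> int (dim A) + f X - int (dim (X \<inter> A))" by simp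
    have "dim {a + b |a b. a \<in> X \<and> b \<in> A} + dim (X \<inter> A) = dim X + dim A"
      using X A AB fin by (intro dim_sum_Int) auto
    moreover have "int (dim {a + b |a b. a \<in> X \<and> b \<in> A}) \<le> int (dim B)"
      using X A AB B by (intro dm subspace_sums) (auto simp: subspace_add subset_iff)
    ultimately show ?thesis using 1 X(3) by linarith
  qed
  moreover have "free_rank f {a + b |a b. a \<in> A \<and> b \<in> B} + free_rank f (A \<inter> B)
      \<le> free_rank f A + free_rank f B"
    if A: "subspace A" "A \<subseteq> E" and B: "subspace B" "B \<subseteq> E" for A B
  proof -
    let ?sum = "\<lambda>A B. {a + b |a b. a \<in> A \<and> b \<in> B}"
    obtain X where X: "subspace X" "X \<subseteq> A" "free_rank f A = int (dim A) + f X - int (dim X)"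
      using free_rank_attained[OF fin[OF A(2)] A(1), of f] by blast
    obtain Y where Y: "subspace Y" "Y \<subseteq> B" "free_rank f B = int (dim B) + f Y - int (dim Y)"
      using free_rank_attained[OF fin[OF B(2)] B(1), of f] by blast
    have XE: "X \<subseteq> E" "Y \<subseteq> E" using X Y A B by auto
    have sE: "?sum A B \<subseteq> E" using A B E by (auto simp: subspace_add subset_iff)
    have "free_rank f (?sum A B) \<le> int (dim (?sum A B)) + f (?sum X Y) - int (dim (?sum X Y))"
      using fin[OF sE] X Y by (intro free_rank_le subspace_sums) auto
    moreover have "free_rank f (A \<inter> B) \<le> int (dim (A \<inter> B)) + f (X \<inter> Y) - int (dim (X \<inter> Y))"
      using fin[of "A \<inter> B"] A X Y by (intro free_rank_le subspace_inter) auto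
    moreover have "f (?sum X Y) + f (X \<inter> Y) \<le> f X + f Y"
      using X Y XE by (intro submod) auto
    moreover have "dim (?sum A B) + dim (A \<inter> B) = dim A + dim B"
      using A B fin by (intro dim_sum_Int) auto
    moreover have "dim (?sum X Y) + dim (X \<inter> Y) = dim X + dim Y"
      using X Y XE fin by (intro dim_sum_Int) auto
    ultimately show ?thesis using X(3) Y(3) by linarith
  qed
  moreover have "\<exists>B. finite B \<and> E = span B" using E by (intro exI[of _ E]) (simp add: span_eq_iff[THEN iffD2])
  ultimately show ?thesis unfolding q_matroid_def subspaces_of_def by auto
qed

end

text \<open>The rank of \<open>V\<close> is the largest dimension of an independent subspace of \<open>V\<close>, and \<open>f\<close> matches the
  independent subspaces of \<open>V\<close> with those of its image.\<close>

lemma rank_eq_if_same_indep: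
  fixes s1 :: "'f::{field,finite} \<Rightarrow> 'v::ab_group_add \<Rightarrow> 'v"
    and s2 :: "'f \<Rightarrow> 'w::ab_group_add \<Rightarrow> 'w"
  assumes f: "Vector_Spaces.linear s1 s2 f"
    and M1: "q_matroid s1 (E1, \<rho>1)" "finite E1" and M2: "q_matroid s2 (E2, \<rho>2)"
    and bij: "bij_betw f E1 E2"
    and ind: "\<And>I. module.subspace s1 I \<Longrightarrow> I \<subseteq> E1 \<Longrightarrow>
       \<rho>1 I = int (vector_space.dim s1 I) \<longleftrightarrow> \<rho>2 (f ` I) = int (vector_space.dim s2 (f ` I))"
    and V: "module.subspace s1 V" "V \<subseteq> E1"
  shows "\<rho>1 V = \<rho>2 (f ` V)"
proof -
  interpret a: finite_scalars s1 using f by (simp add: finite_scalars_def Vector_Spaces.linear_def)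
  interpret b: finite_scalars s2 using f by (simp add: finite_scalars_def Vector_Spaces.linear_def)
  interpret f: Vector_Spaces.linear s1 s2 f by (rule f)
  have E2: "E2 = f ` E1" "inj_on f E1" "finite E2" using bij M1(2) by (auto simp: bij_betw_def)
  have dim: "b.dim (f ` I) = a.dim I" if "a.subspace I" "I \<subseteq> E1" for I
    using that E2 M1(2) inj_on_subset finite_subset by (intro dim_image_inj_on[OF f]) blast+
  have sub: "b.subspace (f ` I)" if "a.subspace I" for I using that by (rule f.subspace_image)
  have fV: "b.subspace (f ` V)" "f ` V \<subseteq> E2" using V sub E2 by auto
  show ?thesis
  proof (rule antisym)
    obtain I where I: "a.subspace I" "I \<subseteq> V" "\<rho>1 I = int (a.dim I)" "\<rho>1 V = int (a.dim I)"
      using a.qm_exists_basis[OF M1 V] by blast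
    have "\<rho>2 (f ` I) = int (a.dim I)" using ind[of I] I V dim[of I] by auto
    moreover have "\<rho>2 (f ` I) \<le> \<rho>2 (f ` V)"
      using I sub fV by (intro b.qm_mono[OF M2 E2(3)]) auto
    ultimately show "\<rho>1 V \<le> \<rho>2 (f ` V)" using I by simp
  next
    obtain J where J: "b.subspace J" "J \<subseteq> f ` V" "\<rho>2 J = int (b.dim J)" "\<rho>2 (f ` V) = int (b.dim J)"
      using b.qm_exists_basis[OF M2 E2(3) fV] by blast
    let ?I = "V \<inter> f -` J"
    have I: "a.subspace ?I" by (rule a.subspace_inter[OF V(1) f.subspace_vimage[OF J(1)]])
    have eq: "f ` ?I = J" using J(2) by auto
    have "\<rho>1 ?I = int (a.dim ?I)" using ind[of ?I] I V J eq by auto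
    moreover have "\<rho>1 ?I \<le> \<rho>1 V" using I V by (intro a.qm_mono[OF M1]) auto
    moreover have "a.dim ?I = b.dim J" using dim[OF I le_infI1[OF V(2)]] eq by simp
    ultimately show "\<rho>2 (f ` V) \<le> \<rho>1 V" using J by simp
  qed
qed

section \<open>The rank function of an iterated direct sum\<close>

text \<open>
  This is the associativity of the direct sum.  A minimizer \<open>X\<close> of the outer minimum and a minimizer \<open>Y \<le> T ` X\<close>
  of the inner one combine into the single subspace \<open>X \<inter> T -` Y\<close>: it has the same kernel under \<open>T\<close> as \<open>X\<close>, so
  the dimension that is lost equals \<open>dim (T ` X) - dim Y\<close>.
\<close>

lemma free_rank_nested:
  fixes s1 :: "'f::{field,finite} \<Rightarrow> 'v::ab_group_add \<Rightarrow> 'v"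
    and s2 :: "'f \<Rightarrow> 'w::ab_group_add \<Rightarrow> 'w"
  assumes T: "Vector_Spaces.linear s1 s2 T"
    and V: "module.subspace s1 V" "finite V"
    and mono: "\<And>A B. module.subspace s1 A \<Longrightarrow> module.subspace s1 B \<Longrightarrow> A \<subseteq> B \<Longrightarrow> B \<subseteq> V \<Longrightarrow> g A \<le> g B"
  shows "finite_scalars.free_rank s1 (\<lambda>X. finite_scalars.free_rank s2 f (T ` X) + g X) V =
         finite_scalars.free_rank s1 (\<lambda>X. f (T ` X) + g X) V"
proof -
  interpret a: finite_scalars s1 using T by (simp add: finite_scalars_def Vector_Spaces.linear_def)
  interpret b: finite_scalars s2 using T by (simp add: finite_scalars_def Vector_Spaces.linear_def)
  interpret T: Vector_Spaces.linear s1 s2 T by (rule T)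
  show ?thesis
  proof (rule a.free_rank_eqI[OF V(2,1)])
    obtain X where X: "a.subspace X" "X \<subseteq> V"
      "a.free_rank (\<lambda>X. f (T ` X) + g X) V = int (a.dim V) + (f (T ` X) + g X) - int (a.dim X)"
      using a.free_rank_attained[OF V(2,1), of "\<lambda>X. f (T ` X) + g X"] by blast
    have fT: "finite (T ` X)" using finite_subset[OF X(2) V(2)] by simp
    have "b.free_rank f (T ` X) \<le> int (b.dim (T ` X)) + f (T ` X) - int (b.dim (T ` X))"
      using fT T.subspace_image[OF X(1)] by (intro b.free_rank_le) auto
    then show "\<exists>X. a.subspace X \<and> X \<subseteq> V \<and>
        int (a.dim V) + (b.free_rank f (T ` X) + g X) - int (a.dim X)
          \<le> a.free_rank (\<lambda>X. f (T ` X) + g X) V"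
      using X by (intro exI[of _ X]) simp
  next
    fix X assume X: "a.subspace X" "X \<subseteq> V"
    have fX: "finite X" using finite_subset[OF X(2) V(2)] .
    have TX: "b.subspace (T ` X)" "finite (T ` X)" using X fX T.subspace_image by auto
    obtain Y where Y: "b.subspace Y" "Y \<subseteq> T ` X"
      "b.free_rank f (T ` X) = int (b.dim (T ` X)) + f Y - int (b.dim Y)"
      using b.free_rank_attained[OF TX(2,1), of f] by blast
    let ?X = "X \<inter> T -` Y"
    have sX: "a.subspace ?X" by (rule a.subspace_inter[OF X(1) T.subspace_vimage[OF Y(1)]])
    have TX': "T ` ?X = Y" using Y(2) by auto
    have "a.free_rank (\<lambda>X. f (T ` X) + g X) V \<le> int (a.dim V) + (f (T ` ?X) + g ?X) - int (a.dim ?X)"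
      using X by (intro a.free_rank_le[OF V(2) sX]) auto
    moreover have "g ?X \<le> g X" using X by (intro mono[OF sX X(1)]) auto
    moreover have "a.dim X = a.dim {x \<in> X. T x = 0} + b.dim (T ` X)"
      by (rule dim_kernel_image[OF T X(1) fX])
    moreover have "a.dim ?X = a.dim {x \<in> ?X. T x = 0} + b.dim (T ` ?X)"
      using fX by (intro dim_kernel_image[OF T sX]) auto
    moreover have "a.dim {x \<in> ?X. T x = 0} = a.dim {x \<in> X. T x = 0}"
      using b.subspace_0[OF Y(1)] by (intro arg_cong[of _ _ a.dim]) auto
    ultimately show "a.free_rank (\<lambda>X. f (T ` X) + g X) V
        \<le> int (a.dim V) + (b.free_rank f (T ` X) + g X) - int (a.dim X)"
      using Y(3) unfolding TX' by linarith
  qed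
qed

lemma free_rank_cong:
  assumes "vector_space s"
    and "\<And>X. module.subspace s X \<Longrightarrow> X \<subseteq> V \<Longrightarrow> f X = g X"
  shows "finite_scalars.free_rank s f V = finite_scalars.free_rank s g V"
proof -
  interpret finite_scalars s using assms by (simp add: finite_scalars_def)
  have "(\<lambda>X. f X - int (dim X)) ` subspaces_of s V = (\<lambda>X. g X - int (dim X)) ` subspaces_of s V"
    using assms(2) by (intro image_cong) (auto simp: subspaces_of_def)
  then show ?thesis by (simp add: free_rank_def)
qed

lemma free_rank_image:
  fixes s1 :: "'f::{field,finite} \<Rightarrow> 'v::ab_group_add \<Rightarrow> 'v"
    and s2 :: "'f \<Rightarrow> 'w::ab_group_add \<Rightarrow> 'w"
  assumes T: "Vector_Spaces.linear s1 s2 T" and V: "module.subspace s1 V" "finite V" "inj_on T V"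
  shows "finite_scalars.free_rank s2 f (T ` V) = finite_scalars.free_rank s1 (\<lambda>X. f (T ` X)) V"
proof -
  interpret a: finite_scalars s1 using T by (simp add: finite_scalars_def Vector_Spaces.linear_def)
  interpret b: finite_scalars s2 using T by (simp add: finite_scalars_def Vector_Spaces.linear_def)
  interpret T: Vector_Spaces.linear s1 s2 T by (rule T)
  have dim: "b.dim (T ` X) = a.dim X" if "a.subspace X" "X \<subseteq> V" for X
    using that V inj_on_subset finite_subset by (intro dim_image_inj_on[OF T]) blast+
  have "subspaces_of s2 (T ` V) = (`) T ` subspaces_of s1 V"
  proof (intro equalityI subsetI)
    fix Y assume "Y \<in> subspaces_of s2 (T ` V)"
    then have Y: "b.subspace Y" "Y \<subseteq> T ` V" by (auto simp: subspaces_of_def)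
    have "a.subspace (V \<inter> T -` Y)"
      by (rule a.subspace_inter[OF V(1) T.subspace_vimage[OF Y(1)]])
    moreover have "T ` (V \<inter> T -` Y) = Y" using Y(2) by auto
    ultimately show "Y \<in> (`) T ` subspaces_of s1 V"
      by (intro image_eqI[of _ _ "V \<inter> T -` Y"]) (auto simp: subspaces_of_def)
  qed (auto simp: subspaces_of_def T.subspace_image)
  then have "(\<lambda>X. f X - int (b.dim X)) ` subspaces_of s2 (T ` V) =
      (\<lambda>X. f (T ` X) - int (a.dim X)) ` subspaces_of s1 V"
    using dim by (auto simp: image_image subspaces_of_def intro!: image_cong)
  then show ?thesis using dim[OF V(1)] by (simp add: a.free_rank_def b.free_rank_def)
qed

lemma vector_space_prod_scale:
  assumes "vector_space s1" "vector_space s2"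
  shows "vector_space (module_prod.scale s1 s2)"
    and "module_prod.scale s1 s2 c (x, y) = (s1 c x, s2 c y)"
proof -
  interpret a: vector_space s1 by fact
  interpret b: vector_space s2 by fact
  interpret vector_space_prod s1 s2 ..
  show "vector_space (module_prod.scale s1 s2)" by (rule p.vector_space_axioms)
  show "module_prod.scale s1 s2 c (x, y) = (s1 c x, s2 c y)" by (rule scale_prod)
qed

lemma qm_dsum_rank:
  assumes "vector_space s1" "vector_space s2"
  shows "snd (qm_dsum s1 s2 M1 M2) =
    finite_scalars.free_rank (module_prod.scale s1 s2) (\<lambda>X. snd M1 (fst ` X) + snd M2 (snd ` X))"
proof -
  interpret p: finite_scalars "module_prod.scale s1 s2"
    using vector_space_prod_scale[OF assms] by (simp add: finite_scalars_def)
  show ?thesis by (simp add: qm_dsum_def Let_def p.free_rank_def fun_eq_iff)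
qed

lemma qm_dsums_ground:
  "fst (qm_dsums s M r) = {w. (\<forall>i\<le>r. w i \<in> fst (M i)) \<and> (\<forall>i>r. w i = 0)}"
proof (induction r)
  case 0
  show ?case
  proof (intro equalityI subsetI)
    fix w assume "w \<in> {w. (\<forall>i\<le>0. w i \<in> fst (M i)) \<and> (\<forall>i>0. w i = 0)}"
    then show "w \<in> fst (qm_dsums s M 0)"
      by (auto simp: qm_map_def fun_eq_iff intro!: image_eqI[of _ _ "w 0"])
  qed (auto simp: qm_map_def)
next
  case (Suc r)
  show ?case
  proof (intro equalityI subsetI)
    fix w assume w: "w \<in> {w. (\<forall>i\<le>Suc r. w i \<in> fst (M i)) \<and> (\<forall>i>Suc r. w i = 0)}"
    have "w(Suc r := 0) \<in> {w. (\<forall>i\<le>r. w i \<in> fst (M i)) \<and> (\<forall>i>r. w i = 0)}" using w by auto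
    then show "w \<in> fst (qm_dsums s M (Suc r))" using w
      by (auto simp: qm_map_def qm_dsum_def Let_def Suc intro!: image_eqI[of _ _ "(w(Suc r := 0), w (Suc r))"])
  qed (auto simp: qm_map_def qm_dsum_def Let_def Suc le_Suc_eq)
qed

lemma linear_component:
  assumes "vector_space s"
  shows "Vector_Spaces.linear (pointwise s) s (\<lambda>w. w i)"
  using assms vector_space_pointwise[OF assms] by (simp add: Vector_Spaces.linear_iff pointwise_def)

text \<open>
  Passing from \<open>r\<close> to \<open>r + 1\<close> identifies a sequence with the pair of its truncation and its last entry, which turns
  the transported binary sum into a nested minimum.  A single summand is covered because, by unit increase, the
  minimum is attained at the whole space.
\<close>

lemma qm_dsums_rank:
  fixes s :: "'f::{field,finite} \<Rightarrow> 'v::ab_group_add \<Rightarrow> 'v"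
  assumes s: "vector_space s"
    and M: "\<And>i. i \<le> r \<Longrightarrow> q_matroid s (M i)" "\<And>i. i \<le> r \<Longrightarrow> finite (fst (M i))"
    and V: "module.subspace (pointwise s) V" "V \<subseteq> fst (qm_dsums s M r)" "finite V"
  shows "snd (qm_dsums s M r) V =
    finite_scalars.free_rank (pointwise s) (\<lambda>X. \<Sum>i\<le>r. snd (M i) ((\<lambda>w. w i) ` X)) V"
  using M V
proof (induction r arbitrary: V)
  case 0
  interpret a: finite_scalars s using s by (simp add: finite_scalars_def)
  interpret p: finite_scalars "pointwise s" using vector_space_pointwise[OF s] by (simp add: finite_scalars_def)
  interpret T: Vector_Spaces.linear "pointwise s" s "\<lambda>w. w 0" by (rule linear_component[OF s])
  have M0: "q_matroid s (fst (M 0), snd (M 0))" using 0 by simp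
  have VE: "V \<subseteq> {w. w 0 \<in> fst (M 0) \<and> (\<forall>i>0. w i = 0)}" using 0(4) unfolding qm_dsums_ground by auto
  then have inj: "inj_on (\<lambda>w. w 0) V"
    by (intro inj_onI ext) (metis (mono_tags, lifting) gr0I mem_Collect_eq subset_iff)
  have "(\<lambda>x. 0(0 := x)) -` V \<inter> fst (M 0) = (\<lambda>w. w 0) ` V"
  proof (intro equalityI subsetI)
    fix x assume "x \<in> (\<lambda>w. w 0) ` V"
    then obtain w where w: "w \<in> V" "x = w 0" by auto
    moreover have "0(0 := w 0) = w" using w VE by (auto simp: fun_eq_iff)
    ultimately show "x \<in> (\<lambda>x. 0(0 := x)) -` V \<inter> fst (M 0)" using VE by auto
  next
    fix x assume "x \<in> (\<lambda>x. 0(0 := x)) -` V \<inter> fst (M 0)"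
    then show "x \<in> (\<lambda>w. w 0) ` V" by (intro image_eqI[of _ _ "0(0 := x)"]) auto
  qed
  then have "snd (qm_dsums s M 0) V = snd (M 0) ((\<lambda>w. w 0) ` V)"
    by (simp add: qm_map_def)
  moreover have "p.free_rank (\<lambda>X. snd (M 0) ((\<lambda>w. w 0) ` X)) V = snd (M 0) ((\<lambda>w. w 0) ` V)"
  proof (rule p.free_rank_eqI)
    fix X assume X: "p.subspace X" "X \<subseteq> V"
    have d: "a.dim ((\<lambda>w. w 0) ` Y) = p.dim Y" if "p.subspace Y" "Y \<subseteq> V" for Y
      by (rule dim_image_inj_on[OF T.linear_axioms that(1) finite_subset[OF that(2) 0(5)] inj_on_subset[OF inj that(2)]])
    have "snd (M 0) ((\<lambda>w. w 0) ` V) + int (a.dim ((\<lambda>w. w 0) ` X))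
        \<le> snd (M 0) ((\<lambda>w. w 0) ` X) + int (a.dim ((\<lambda>w. w 0) ` V))"
      using 0 X VE by (intro a.qm_unit_increase[OF M0] T.subspace_image) auto
    then show "snd (M 0) ((\<lambda>w. w 0) ` V) \<le> int (p.dim V) + snd (M 0) ((\<lambda>w. w 0) ` X) - int (p.dim X)"
      using d[OF X] d[of V] 0 by simp
  qed (use 0 in auto)
  ultimately show ?case by simp
next
  case (Suc r)
  let ?n = "Suc r" and ?p = "pointwise s"
  let ?ps = "module_prod.scale ?p s"
  let ?f = "\<lambda>r X. \<Sum>i\<le>r. snd (M i) ((\<lambda>w. w i) ` X)"
  let ?T = "\<lambda>w. w(Suc r := 0)"
  let ?g = "\<lambda>w. (w(Suc r := 0), w (Suc r))"
  let ?h = "\<lambda>(w, x). w(Suc r := x)"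
  note vp = vector_space_pointwise[OF s]
  interpret a: finite_scalars s using s by (simp add: finite_scalars_def)
  interpret p: finite_scalars ?p using vp by (simp add: finite_scalars_def)
  interpret pp: finite_scalars ?ps
    using vector_space_prod_scale(1)[OF vp s] by (simp add: finite_scalars_def)
  have linT: "Vector_Spaces.linear ?p ?p ?T"
    using vp by (auto simp: Vector_Spaces.linear_iff pointwise_def fun_eq_iff)
  interpret T: Vector_Spaces.linear ?p ?p ?T by (rule linT)
  have ling: "Vector_Spaces.linear ?p ?ps ?g"
    using vp pp.vector_space_axioms vector_space_prod_scale(2)[OF vp s]
    by (auto simp: Vector_Spaces.linear_iff pointwise_def fun_eq_iff)
  let ?E = "fst (qm_dsums s M r)" and ?F = "fst (M ?n)"
  have VE: "\<And>w. w \<in> V \<Longrightarrow> ?T w \<in> ?E \<and> w ?n \<in> ?F"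
    using Suc.prems(4) unfolding qm_dsums_ground by auto
  have E0: "\<And>w. w \<in> ?E \<Longrightarrow> w ?n = 0" by (auto simp: qm_dsums_ground)
  have "?h -` V \<inter> (?E \<times> ?F) = ?g ` V"
  proof (intro equalityI subsetI)
    fix z assume "z \<in> ?g ` V"
    then show "z \<in> ?h -` V \<inter> (?E \<times> ?F)" using VE by auto
  next
    fix z assume z: "z \<in> ?h -` V \<inter> (?E \<times> ?F)"
    obtain w x where wx: "z = (w, x)" by (cases z)
    have "w(Suc r := 0) = w" using E0[of w] z wx by (auto simp: fun_eq_iff)
    then show "z \<in> ?g ` V" using z wx by (intro image_eqI[of _ _ "w(Suc r := x)"]) auto
  qed
  moreover have "fst (qm_dsum ?p s (qm_dsums s M r) (M ?n)) = ?E \<times> ?F"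
    by (simp add: qm_dsum_def Let_def)
  ultimately have "snd (qm_dsums s M ?n) V = snd (qm_dsum ?p s (qm_dsums s M r) (M ?n)) (?g ` V)"
    by (simp add: qm_map_def del: vimage_Int)
  also have "\<dots> = pp.free_rank (\<lambda>X. snd (qm_dsums s M r) (fst ` X) + snd (M ?n) (snd ` X)) (?g ` V)"
    by (simp add: qm_dsum_rank[OF vp s])
  also have "\<dots> = p.free_rank (\<lambda>X. snd (qm_dsums s M r) (fst ` ?g ` X) + snd (M ?n) (snd ` ?g ` X)) V"
  proof (rule free_rank_image[OF ling Suc.prems(3,5)])
    show "inj_on ?g V" by (auto simp: inj_on_def fun_eq_iff) metis
  qed
  also have "\<dots> = p.free_rank (\<lambda>X. p.free_rank (?f r) (?T ` X) + snd (M ?n) ((\<lambda>w. w ?n) ` X)) V"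
  proof (rule free_rank_cong[OF vp])
    fix X assume X: "p.subspace X" "X \<subseteq> V"
    have "snd (qm_dsums s M r) (?T ` X) = p.free_rank (?f r) (?T ` X)"
    proof (rule Suc.IH)
      show "p.subspace (?T ` X)" by (rule T.subspace_image[OF X(1)])
      show "?T ` X \<subseteq> ?E" using X VE by auto
      show "finite (?T ` X)" using X Suc.prems(5) finite_subset by blast
    qed (use Suc.prems in auto)
    then show "snd (qm_dsums s M r) (fst ` ?g ` X) + snd (M ?n) (snd ` ?g ` X) =
        p.free_rank (?f r) (?T ` X) + snd (M ?n) ((\<lambda>w. w ?n) ` X)"
      by (simp add: image_image)
  qed
  also have "\<dots> = p.free_rank (\<lambda>X. ?f r (?T ` X) + snd (M ?n) ((\<lambda>w. w ?n) ` X)) V"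
  proof (rule free_rank_nested[OF linT Suc.prems(3,5)])
    interpret c: Vector_Spaces.linear ?p s "\<lambda>w. w ?n" by (rule linear_component[OF s])
    have Q: "q_matroid s (?F, snd (M ?n))" using Suc.prems by simp
    fix A B assume "p.subspace A" "p.subspace B" "A \<subseteq> B" "B \<subseteq> V"
    then show "snd (M ?n) ((\<lambda>w. w ?n) ` A) \<le> snd (M ?n) ((\<lambda>w. w ?n) ` B)"
      using VE Suc.prems(2)[of ?n] by (intro a.qm_mono[OF Q] c.subspace_image) auto
  qed
  also have "\<dots> = p.free_rank (?f ?n) V"
  proof -
    have "?f r (?T ` X) = ?f r X" for X by (intro sum.cong) (auto simp: image_image)
    then show ?thesis by simp
  qed
  finally show ?case .
qed

lemma q_matroid_qm_dsums:
  fixes s :: "'f::{field,finite} \<Rightarrow> 'v::ab_group_add \<Rightarrow> 'v"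
  assumes s: "vector_space s"
    and M: "\<And>i. i \<le> r \<Longrightarrow> q_matroid s (M i)" "\<And>i. i \<le> r \<Longrightarrow> finite (fst (M i))"
    and fin: "finite (fst (qm_dsums s M r))"
  shows "q_matroid (pointwise s) (qm_dsums s M r)"
    and "module.subspace (pointwise s) (fst (qm_dsums s M r))"
proof -
  interpret a: finite_scalars s using s by (simp add: finite_scalars_def)
  interpret p: finite_scalars "pointwise s"
    using vector_space_pointwise[OF s] by (simp add: finite_scalars_def)
  let ?E = "fst (qm_dsums s M r)"
  let ?f = "\<lambda>X. \<Sum>i\<le>r. snd (M i) ((\<lambda>w. w i) ` X)"
  have Q: "q_matroid s (fst (M i), snd (M i))" if "i \<le> r" for i using M that by simp
  have g: "a.subspace (fst (M i))" if "i \<le> r" for i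
    using a.qm_ground[OF Q M(2)] that by simp
  show E: "p.subspace ?E"
    unfolding qm_dsums_ground
    by (rule p.subspaceI)
      (auto simp: pointwise_def intro: a.subspace_0[OF g] a.subspace_add[OF g] a.subspace_scale[OF g])
  have im: "a.subspace ((\<lambda>w. w i) ` A)" if "p.subspace A" for A i
  proof -
    interpret c: Vector_Spaces.linear "pointwise s" s "\<lambda>w. w i" by (rule linear_component[OF s])
    show ?thesis by (rule c.subspace_image[OF that])
  qed
  have imE: "(\<lambda>w. w i) ` A \<subseteq> fst (M i)" if "A \<subseteq> ?E" "i \<le> r" for A i
    using that by (auto simp: qm_dsums_ground)
  have "q_matroid (pointwise s) (?E, p.free_rank ?f)"
  proof (rule p.q_matroid_free_rank[OF E fin])
    have "snd (M i) {0} = 0" if "i \<le> r" for i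
      using a.qm_bounds[OF Q M(2), of i "{0}"] that a.subspace_0[OF g[OF that]] by auto
    moreover have "(\<lambda>w. w i) ` {0 :: nat \<Rightarrow> 'v} = {0}" for i by simp
    ultimately show "?f {0} = 0" by simp
  next
    fix A B assume AB: "p.subspace A" "p.subspace B" "A \<subseteq> B" "B \<subseteq> ?E"
    then show "?f A \<le> ?f B"
      using im imE M(2) by (intro sum_mono a.qm_mono[OF Q]) auto
  next
    fix A B assume A: "p.subspace A" "A \<subseteq> ?E" and B: "p.subspace B" "B \<subseteq> ?E"
    let ?S = "{a + b |a b. a \<in> A \<and> b \<in> B}"
    have "snd (M i) ((\<lambda>w. w i) ` ?S) + snd (M i) ((\<lambda>w. w i) ` (A \<inter> B))
        \<le> snd (M i) ((\<lambda>w. w i) ` A) + snd (M i) ((\<lambda>w. w i) ` B)" if i: "i \<le> r" for i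
    proof -
      let ?A = "(\<lambda>w. w i) ` A" and ?B = "(\<lambda>w. w i) ` B"
      have "(\<lambda>w. w i) ` ?S = {a + b |a b. a \<in> ?A \<and> b \<in> ?B}"
        by (force simp: image_iff)
      moreover have "snd (M i) {a + b |a b. a \<in> ?A \<and> b \<in> ?B} + snd (M i) (?A \<inter> ?B)
          \<le> snd (M i) ?A + snd (M i) ?B"
        using A B i im imE M(2) by (intro a.qm_submod[OF Q]) auto
      moreover have "snd (M i) ((\<lambda>w. w i) ` (A \<inter> B)) \<le> snd (M i) (?A \<inter> ?B)"
        using A B i im imE[OF A(2) i] M(2)
        by (intro a.qm_mono[OF Q] a.subspace_inter im p.subspace_inter) auto
      ultimately show ?thesis by simp
    qed
    then show "?f ?S + ?f (A \<inter> B) \<le> ?f A + ?f B"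
      unfolding sum.distrib[symmetric] by (intro sum_mono) simp
  qed
  moreover have "snd (qm_dsums s M r) V = p.free_rank ?f V" if "p.subspace V" "V \<subseteq> ?E" for V
    using that finite_subset[OF that(2) fin] M by (intro qm_dsums_rank[OF s]) auto
  moreover have "p.subspace {a + b |a b. a \<in> A \<and> b \<in> B} \<and> {a + b |a b. a \<in> A \<and> b \<in> B} \<subseteq> ?E"
    if "p.subspace A" "A \<subseteq> ?E" "p.subspace B" "B \<subseteq> ?E" for A B
    using that E p.subspace_sums[of A B] by (auto simp: p.subspace_add subset_iff)
  ultimately have "q_matroid (pointwise s) (?E, snd (qm_dsums s M r))"
    unfolding q_matroid_def subspaces_of_def by (auto simp: p.subspace_inter le_infI1)
  then show "q_matroid (pointwise s) (qm_dsums s M r)" by simp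
qed

section \<open>Independence in a direct sum of uniform \<open>q\<close>-matroids\<close>

text \<open>
  Setting the coordinates in \<open>J\<close> to zero has the first summand as its kernel; its image embeds into the
  product of the remaining projections.
\<close>

lemma dim_le_components:
  fixes s :: "'f::{field,finite} \<Rightarrow> 'v::ab_group_add \<Rightarrow> 'v"
  assumes s: "vector_space s" and X: "module.subspace (pointwise s) X" "finite X"
    and sup: "\<And>w i. w \<in> X \<Longrightarrow> i \<notin> A \<Longrightarrow> w i = 0" and "finite A"
  shows "vector_space.dim (pointwise s) X \<le>
    vector_space.dim (pointwise s) (X \<inter> {w. \<forall>i. i \<notin> J \<longrightarrow> w i = 0}) +
    (\<Sum>i\<in>A - J. vector_space.dim s ((\<lambda>w. w i) ` X))"
proof -
  interpret a: finite_scalars s using s by (simp add: finite_scalars_def)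
  interpret p: finite_scalars "pointwise s"
    using vector_space_pointwise[OF s] by (simp add: finite_scalars_def)
  let ?T = "\<lambda>w i. if i \<in> J then 0 else w i"
  have T: "Vector_Spaces.linear (pointwise s) (pointwise s) ?T"
    using s vector_space_pointwise[OF s] by (auto simp: Vector_Spaces.linear_iff pointwise_def fun_eq_iff)
  interpret T: Vector_Spaces.linear "pointwise s" "pointwise s" ?T by (rule T)
  have im: "a.subspace ((\<lambda>w. w i) ` X)" for i
  proof -
    interpret c: Vector_Spaces.linear "pointwise s" s "\<lambda>w. w i" by (rule linear_component[OF s])
    show ?thesis by (rule c.subspace_image[OF X(1)])
  qed
  let ?P = "PiE (A - J) (\<lambda>i. (\<lambda>w. w i) ` X)"
  have "card (?T ` X) \<le> card ?P"
  proof (rule card_inj_on_le[where f = "\<lambda>w. restrict w (A - J)"])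
    show "inj_on (\<lambda>w. restrict w (A - J)) (?T ` X)"
    proof (rule inj_onI, rule ext)
      fix v w i assume v: "v \<in> ?T ` X" and w: "w \<in> ?T ` X"
        and e: "restrict v (A - J) = restrict w (A - J)"
      show "v i = w i"
      proof (cases "i \<in> A - J")
        case True then show ?thesis using fun_cong[OF e, of i] by simp
      next
        case False
        from v w obtain x y where "x \<in> X" "y \<in> X" "v = ?T x" "w = ?T y" by auto
        with False sup[of x i] sup[of y i] show ?thesis by auto
      qed
    qed
    show "(\<lambda>w. restrict w (A - J)) ` (?T ` X) \<subseteq> ?P"
      unfolding image_image
    proof (rule image_subsetI)
      fix x assume "x \<in> X"
      then show "restrict (?T x) (A - J) \<in> ?P" by (intro restrict_PiE_iff[THEN iffD2]) auto
    qed
    show "finite ?P" using \<open>finite A\<close> X by (intro finite_PiE) auto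
  qed
  also have "card ?P = CARD('f) ^ (\<Sum>i\<in>A - J. a.dim ((\<lambda>w. w i) ` X))"
    using a.card_subspace[OF im] X \<open>finite A\<close> by (simp add: card_PiE power_sum)
  finally have "CARD('f) ^ p.dim (?T ` X) \<le> CARD('f) ^ (\<Sum>i\<in>A - J. a.dim ((\<lambda>w. w i) ` X))"
    using p.card_subspace[OF T.subspace_image[OF X(1)]] X by simp
  then have "p.dim (?T ` X) \<le> (\<Sum>i\<in>A - J. a.dim ((\<lambda>w. w i) ` X))"
    using one_less_CARD_field[where 'f = 'f] by (simp add: power_increasing_iff)
  moreover have "{x \<in> X. ?T x = 0} = X \<inter> {w. \<forall>i. i \<notin> J \<longrightarrow> w i = 0}"
    by (auto simp: fun_eq_iff)
  ultimately show ?thesis using dim_kernel_image[OF T X] by simp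
qed

text \<open>
  For given \<open>J\<close>, use \<open>X = V \<inter> E_J\<close>, where \<open>E_J\<close> consists of the sequences supported on \<open>J\<close>.  For given \<open>X\<close>, let \<open>J\<close>
  consist of the indices at which the minimum is \<open>ks i\<close>.
\<close>

lemma uniform_sum_indep_iff:
  fixes s :: "'f::{field,finite} \<Rightarrow> 'v::ab_group_add \<Rightarrow> 'v"
  assumes s: "vector_space s" and V: "module.subspace (pointwise s) V" "finite V"
    and sup: "\<And>w i. w \<in> V \<Longrightarrow> i \<notin> A \<Longrightarrow> w i = 0" and A: "finite A"
  shows "finite_scalars.free_rank (pointwise s)
      (\<lambda>X. \<Sum>i\<in>A. int (min (ks i) (vector_space.dim s ((\<lambda>w. w i) ` X)))) V =
        int (vector_space.dim (pointwise s) V) \<longleftrightarrow>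
    (\<forall>J\<subseteq>A. vector_space.dim (pointwise s) (V \<inter> {w. \<forall>i. i \<notin> J \<longrightarrow> w i = 0}) \<le> sum ks J)"
proof -
  interpret a: finite_scalars s using s by (simp add: finite_scalars_def)
  interpret p: finite_scalars "pointwise s"
    using vector_space_pointwise[OF s] by (simp add: finite_scalars_def)
  let ?d = "\<lambda>i X. a.dim ((\<lambda>w. w i) ` X)"
  let ?f = "\<lambda>X. \<Sum>i\<in>A. int (min (ks i) (?d i X))"
  let ?Z = "\<lambda>J. {w. \<forall>i. i \<notin> J \<longrightarrow> w i = (0::'v)}"
  have f0: "?f {0} = 0" by simp
  have Z: "p.subspace (?Z J)" for J
    by (rule p.subspaceI) (auto simp: pointwise_def)
  show ?thesis unfolding p.free_rank_indep_iff[of V ?f, OF V(2,1) f0]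
  proof (intro iffI allI impI)
    fix J assume R: "\<forall>X. p.subspace X \<and> X \<subseteq> V \<longrightarrow> int (p.dim X) \<le> ?f X" and J: "J \<subseteq> A"
    let ?X = "V \<inter> ?Z J"
    have "int (p.dim ?X) \<le> ?f ?X" using R V Z by (auto intro: p.subspace_inter)
    also have "?f ?X = (\<Sum>i\<in>J. int (min (ks i) (?d i ?X))) + (\<Sum>i\<in>A - J. int (min (ks i) (?d i ?X)))"
      using J A by (metis (no_types, lifting) add.commute sum.subset_diff)
    also have "(\<Sum>i\<in>A - J. int (min (ks i) (?d i ?X))) = 0"
    proof (intro sum.neutral ballI)
      fix i assume "i \<in> A - J"
      then have "(\<lambda>w. w i) ` ?X = {0}" using p.subspace_0[OF V(1)] by (auto intro!: image_eqI[of _ _ 0])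
      then show "int (min (ks i) (?d i ?X)) = 0" by simp
    qed
    also have "(\<Sum>i\<in>J. int (min (ks i) (?d i ?X))) \<le> (\<Sum>i\<in>J. int (ks i))" by (intro sum_mono) simp
    finally show "p.dim ?X \<le> sum ks J" by (simp flip: of_nat_sum)
  next
    fix X assume R: "\<forall>J\<subseteq>A. p.dim (V \<inter> ?Z J) \<le> sum ks J" and "p.subspace X \<and> X \<subseteq> V"
    then have X: "p.subspace X" "X \<subseteq> V" by auto
    have fX: "finite X" using X V finite_subset by blast
    \<comment> \<open>Here the minimum of \<open>ks i\<close> and the dimension of the projection is \<open>ks i\<close>; elsewhere it is the latter.\<close>
    let ?J = "{i \<in> A. ks i \<le> ?d i X}"
    have "p.dim (X \<inter> ?Z ?J) \<le> p.dim (V \<inter> ?Z ?J)"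
      using X(2) V(2)
      by (intro p.dim_mono_subspace p.subspace_inter[OF X(1) Z] p.subspace_inter[OF V(1) Z]) auto
    also have "\<dots> \<le> sum ks ?J" by (rule R[rule_format]) auto
    also have "\<dots> = (\<Sum>i\<in>?J. min (ks i) (?d i X))" by (intro sum.cong) auto
    finally have 1: "p.dim (X \<inter> ?Z ?J) \<le> (\<Sum>i\<in>?J. min (ks i) (?d i X))" .
    have 2: "(\<Sum>i\<in>A - ?J. ?d i X) = (\<Sum>i\<in>A - ?J. min (ks i) (?d i X))"
      by (intro sum.cong) auto
    have "p.dim X \<le> p.dim (X \<inter> ?Z ?J) + (\<Sum>i\<in>A - ?J. ?d i X)"
      using X sup A by (intro dim_le_components[OF s X(1) fX]) auto
    also have "\<dots> \<le> (\<Sum>i\<in>?J. min (ks i) (?d i X)) + (\<Sum>i\<in>A - ?J. min (ks i) (?d i X))"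
      using 1 2 by linarith
    also have "\<dots> = (\<Sum>i\<in>A. min (ks i) (?d i X))"
      using A sum.subset_diff[of ?J A "\<lambda>i. min (ks i) (?d i X)"] by simp
    finally show "int (p.dim X) \<le> ?f X"
      by (metis (no_types, lifting) of_nat_le_iff of_nat_sum sum.cong)
  qed
qed

section \<open>Block decomposition\<close>

lemma bij_betw_vecs: "bij_betw (\<lambda>v. restrict v {..<n}) (vecs n) (PiE {..<n} (\<lambda>_. UNIV :: 'a::zero set))"
  by (rule bij_betw_byWitness[where f' = "\<lambda>v i. if i < n then v i else 0"])
    (auto simp: vecs_def fun_eq_iff PiE_def extensional_def)

lemma card_vecs: "card (vecs n :: (nat \<Rightarrow> 'a::{zero,finite}) set) = CARD('a) ^ n"
  using bij_betw_same_card[OF bij_betw_vecs[of n, where 'a = 'a]] by (simp add: card_PiE)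

lemma finite_vecs: "finite (vecs n :: (nat \<Rightarrow> 'a::{zero,finite}) set)"
  using bij_betw_finite[OF bij_betw_vecs[of n, where 'a = 'a]] by (simp add: finite_PiE)

definition block_part :: "(nat \<Rightarrow> nat) \<Rightarrow> nat \<Rightarrow> (nat \<Rightarrow> 'K::field) \<Rightarrow> (nat \<Rightarrow> 'K)" where
  "block_part ks i v = (\<lambda>j. if j < ks i then v (sum ks {..<i} + j) else 0)"

lemma block_end_le: "i < j \<Longrightarrow> sum ks {..<i} + ks i \<le> sum ks {..<j :: nat}" for ks :: "nat \<Rightarrow> nat"
  using sum_mono2[of "{..<j}" "{..<Suc i}" ks] by auto

lemma block_part_embed:
  assumes "v \<in> vecs (ks i)"
  shows "block_part ks j (block_embed ks i v) = (if i = j then v else 0)"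
proof (cases i j rule: linorder_cases)
  case less
  then show ?thesis using block_end_le[of i j ks]
    by (auto simp: block_part_def block_embed_def fun_eq_iff)
next
  case greater
  then show ?thesis using block_end_le[of j i ks]
    by (auto simp: block_part_def block_embed_def fun_eq_iff)
next
  case equal
  then show ?thesis using assms by (auto simp: block_part_def block_embed_def fun_eq_iff vecs_def)
qed

lemma block_part_in_vecs: "block_part ks i v \<in> vecs (ks i)"
  by (auto simp: block_part_def vecs_def)

lemma linear_block_embed:
  assumes "vector_space s"
  shows "Vector_Spaces.linear (pointwise s) (pointwise s) (block_embed ks i)"
proof -
  interpret vector_space s by fact
  show ?thesis using vector_space_pointwise[OF assms]
    by (auto simp: Vector_Spaces.linear_iff pointwise_def block_embed_def fun_eq_iff)
qed

lemma linear_block_part: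
  assumes "vector_space s"
  shows "Vector_Spaces.linear (pointwise s) (pointwise s) (block_part ks i)"
proof -
  interpret vector_space s by fact
  show ?thesis using vector_space_pointwise[OF assms]
    by (auto simp: Vector_Spaces.linear_iff pointwise_def block_part_def fun_eq_iff)
qed

lemma block_part_sum:
  assumes "finite J" "\<And>j. j \<in> J \<Longrightarrow> v j \<in> vecs (ks j)"
  shows "block_part ks i (\<Sum>j\<in>J. block_embed ks j (v j)) = (if i \<in> J then v i else 0)"
proof -
  interpret Vector_Spaces.linear fscale fscale "block_part ks i"
    by (rule linear_block_part[OF vector_space_mult])
  have "block_part ks i (\<Sum>j\<in>J. block_embed ks j (v j)) = (\<Sum>j\<in>J. if i = j then v j else 0)"
    using assms(2) by (simp add: sum block_part_embed eq_commute cong: sum.cong)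
  also have "\<dots> = (if i \<in> J then v i else 0)" using assms(1) by (simp add: sum.delta)
  finally show ?thesis .
qed

lemma block_sum_bij:
  assumes J: "finite J" and S: "\<And>j. j \<in> J \<Longrightarrow> S j \<subseteq> vecs (ks j)"
  shows "bij_betw (\<lambda>v. \<Sum>j\<in>J. block_embed ks j (v j)) (PiE J S) (block_sum ks J S)"
  unfolding bij_betw_def
proof
  show "inj_on (\<lambda>v. \<Sum>j\<in>J. block_embed ks j (v j)) (PiE J S)"
  proof (rule inj_onI)
    fix v w assume v: "v \<in> PiE J S" and w: "w \<in> PiE J S"
      and e: "(\<Sum>j\<in>J. block_embed ks j (v j)) = (\<Sum>j\<in>J. block_embed ks j (w j))"
    have vw: "v j \<in> vecs (ks j)" "w j \<in> vecs (ks j)" if "j \<in> J" for j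
      using PiE_mem[OF v that] PiE_mem[OF w that] S[OF that] by auto
    have "v i = w i" if "i \<in> J" for i
      using block_part_sum[OF J, of v ks i] block_part_sum[OF J, of w ks i] vw e that
      by simp
    then show "v = w" by (rule PiE_ext[OF v w])
  qed
  show "(\<lambda>v. \<Sum>j\<in>J. block_embed ks j (v j)) ` PiE J S = block_sum ks J S"
  proof (intro equalityI subsetI)
    fix x assume "x \<in> block_sum ks J S"
    then obtain v where v: "x = (\<Sum>j\<in>J. block_embed ks j (v j))" "\<forall>j\<in>J. v j \<in> S j"
      by (auto simp: block_sum_def)
    then show "x \<in> (\<lambda>v. \<Sum>j\<in>J. block_embed ks j (v j)) ` PiE J S"
      by (intro image_eqI[of _ _ "restrict v J"]) (auto intro!: sum.cong)
  qed (auto simp: block_sum_def)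
qed

lemma card_block_sum:
  assumes "finite J" "\<And>j. j \<in> J \<Longrightarrow> S j \<subseteq> vecs (ks j)"
  shows "card (block_sum ks J S) = (\<Prod>j\<in>J. card (S j))"
  using bij_betw_same_card[OF block_sum_bij[OF assms]] assms(1) by (simp add: card_PiE)

lemma finite_block_sum:
  fixes S :: "nat \<Rightarrow> (nat \<Rightarrow> 'K::{field,finite}) set"
  assumes "finite J" "\<And>j. j \<in> J \<Longrightarrow> S j \<subseteq> vecs (ks j)"
  shows "finite (block_sum ks J S)"
proof -
  have "finite (PiE J S)"
    using assms finite_subset[OF assms(2) finite_vecs] by (intro finite_PiE) auto
  then show ?thesis using bij_betw_finite[OF block_sum_bij[OF assms]] by simp
qed

lemma block_sum_subspace:
  fixes s :: "'f::field \<Rightarrow> 'K::field \<Rightarrow> 'K"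
  assumes s: "vector_space s" and S: "\<And>j. j \<in> J \<Longrightarrow> module.subspace (pointwise s) (S j)"
  shows "module.subspace (pointwise s) (block_sum ks J S)"
proof -
  interpret p: vector_space "pointwise s" by (rule vector_space_pointwise[OF s])
  show ?thesis
  proof (rule p.subspaceI)
    have "block_embed ks j (0 :: nat \<Rightarrow> 'K) = 0" for j by (simp add: block_embed_def fun_eq_iff)
    then have "(\<Sum>j\<in>J. block_embed ks j (0 :: nat \<Rightarrow> 'K)) = 0" by simp
    then show "0 \<in> block_sum ks J S" using p.subspace_0[OF S] unfolding block_sum_def
      by (auto intro!: exI[of _ "\<lambda>_. 0"])
  next
    fix x y assume "x \<in> block_sum ks J S" "y \<in> block_sum ks J S"
    then obtain v w where v: "x = (\<Sum>j\<in>J. block_embed ks j (v j))" "\<forall>j\<in>J. v j \<in> S j"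
      and w: "y = (\<Sum>j\<in>J. block_embed ks j (w j))" "\<forall>j\<in>J. w j \<in> S j"
      by (auto simp: block_sum_def)
    have "x + y = (\<Sum>j\<in>J. block_embed ks j (v j + w j))"
      unfolding v w by (simp add: sum.distrib[symmetric] module_hom.add[OF linear_block_embed[OF s, unfolded linear_iff_module_hom]])
    then show "x + y \<in> block_sum ks J S" unfolding block_sum_def
      using v w p.subspace_add[OF S] by (auto intro!: exI[of _ "\<lambda>j. v j + w j"])
  next
    fix c x assume "x \<in> block_sum ks J S"
    then obtain v where v: "x = (\<Sum>j\<in>J. block_embed ks j (v j))" "\<forall>j\<in>J. v j \<in> S j"
      by (auto simp: block_sum_def)
    have "pointwise s c x = (\<Sum>j\<in>J. block_embed ks j (pointwise s c (v j)))"
      unfolding v by (simp add: p.scale_sum_right module_hom.scale[OF linear_block_embed[OF s, unfolded linear_iff_module_hom]])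
    then show "pointwise s c x \<in> block_sum ks J S" unfolding block_sum_def
      using v p.subspace_scale[OF S] by (auto intro!: exI[of _ "\<lambda>j. pointwise s c (v j)"])
  qed
qed

lemma dim_block_sum:
  fixes s :: "'f::{field,finite} \<Rightarrow> 'K::{field,finite} \<Rightarrow> 'K"
  assumes s: "vector_space s" and J: "finite J"
    and S: "\<And>j. j \<in> J \<Longrightarrow> module.subspace (pointwise s) (S j)" "\<And>j. j \<in> J \<Longrightarrow> S j \<subseteq> vecs (ks j)"
  shows "vector_space.dim (pointwise s) (block_sum ks J S) = (\<Sum>j\<in>J. vector_space.dim (pointwise s) (S j))"
proof -
  interpret p: finite_scalars "pointwise s"
    using vector_space_pointwise[OF s] by (simp add: finite_scalars_def)
  have "card (block_sum ks J S) = (\<Prod>j\<in>J. card (S j))" by (rule card_block_sum[OF J S(2)])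
  also have "\<dots> = (\<Prod>j\<in>J. CARD('f) ^ p.dim (S j))"
    using p.card_subspace[OF S(1)] finite_subset[OF S(2) finite_vecs] by (intro prod.cong) auto
  finally have "card (block_sum ks J S) = (\<Prod>j\<in>J. CARD('f) ^ p.dim (S j))" .
  then show ?thesis
    by (intro p.dim_eqI block_sum_subspace[OF s] finite_block_sum[OF J]) (auto simp: S subsetD[OF S(2)] power_sum)
qed

lemma vecs_subspace: "vector_space s \<Longrightarrow> module.subspace (pointwise s) (vecs n)"
proof -
  assume s: "vector_space s"
  interpret a: vector_space s by fact
  interpret p: vector_space "pointwise s" by (rule vector_space_pointwise[OF s])
  show ?thesis by (rule p.subspaceI) (auto simp: vecs_def pointwise_def)
qed

lemma dim_vecs: "vector_space.dim fscale (vecs n :: (nat \<Rightarrow> 'K::{field,finite}) set) = n"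
proof -
  interpret p: finite_scalars "fscale :: 'K \<Rightarrow> _"
    using vector_space_pointwise[OF vector_space_mult] by (simp add: finite_scalars_def)
  show ?thesis by (rule p.dim_eqI[OF vecs_subspace[OF vector_space_mult] finite_vecs card_vecs])
qed

lemma block_embed_in_vecs: "i < t \<Longrightarrow> block_embed ks i v \<in> vecs (sum ks {..<t})"
  using block_end_le[of i t ks] by (auto simp: block_embed_def vecs_def)

text \<open>
  The block sum is contained in \<open>vecs\<close> and has the same cardinality.
\<close>

lemma block_sum_vecs:
  "block_sum ks {..<t} (\<lambda>i. vecs (ks i)) = (vecs (sum ks {..<t}) :: (nat \<Rightarrow> 'K::{field,finite}) set)"
proof (rule card_subset_eq[OF finite_vecs])
  interpret p: vector_space "fscale :: 'K \<Rightarrow> _"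
    by (rule vector_space_pointwise[OF vector_space_mult])
  show "block_sum ks {..<t} (\<lambda>i. vecs (ks i)) \<subseteq> (vecs (sum ks {..<t}) :: (nat \<Rightarrow> 'K) set)"
    by (auto simp: block_sum_def intro!: p.subspace_sum[OF vecs_subspace[OF vector_space_mult]]
        block_embed_in_vecs)
qed (simp add: card_block_sum card_vecs power_sum)

lemma block_sum_mono: "(\<And>j. j \<in> J \<Longrightarrow> S j \<subseteq> S' j) \<Longrightarrow> block_sum ks J S \<subseteq> block_sum ks J S'"
  unfolding block_sum_def by blast

lemma block_sum_iff:
  fixes S :: "nat \<Rightarrow> (nat \<Rightarrow> 'K::{field,finite}) set"
  assumes S: "\<And>j. j \<in> J \<Longrightarrow> S j \<subseteq> vecs (ks j)" and J: "J \<subseteq> {..<t}"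
  shows "v \<in> block_sum ks J S \<longleftrightarrow> v \<in> vecs (sum ks {..<t}) \<and> (\<forall>i\<in>J. block_part ks i v \<in> S i) \<and>
    (\<forall>i\<in>{..<t} - J. block_part ks i v = 0)"
proof
  have fJ: "finite J" using J finite_subset by blast
  interpret p: vector_space "fscale :: 'K \<Rightarrow> _"
    by (rule vector_space_pointwise[OF vector_space_mult])
  assume "v \<in> block_sum ks J S"
  then obtain w where w: "v = (\<Sum>j\<in>J. block_embed ks j (w j))" "\<forall>j\<in>J. w j \<in> S j"
    by (auto simp: block_sum_def)
  have "v \<in> vecs (sum ks {..<t})" unfolding w using J
    by (auto intro!: p.subspace_sum[OF vecs_subspace[OF vector_space_mult]] block_embed_in_vecs)
  moreover have "block_part ks i v = (if i \<in> J then w i else 0)" for i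
    unfolding w using w S by (intro block_part_sum[OF fJ]) auto
  ultimately show "v \<in> vecs (sum ks {..<t}) \<and> (\<forall>i\<in>J. block_part ks i v \<in> S i) \<and>
    (\<forall>i\<in>{..<t} - J. block_part ks i v = 0)" using w by auto
next
  assume R: "v \<in> vecs (sum ks {..<t}) \<and> (\<forall>i\<in>J. block_part ks i v \<in> S i) \<and>
    (\<forall>i\<in>{..<t} - J. block_part ks i v = 0)"
  then have "v \<in> block_sum ks {..<t} (\<lambda>i. vecs (ks i))" by (simp add: block_sum_vecs)
  then obtain w where w: "v = (\<Sum>j\<in>{..<t}. block_embed ks j (w j))" "\<forall>j\<in>{..<t}. w j \<in> vecs (ks j)"
    by (auto simp: block_sum_def)
  have b: "block_part ks i v = w i" if "i < t" for i
    unfolding w using w that by (subst block_part_sum) auto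
  have z: "block_embed ks j 0 = 0" for j by (simp add: block_embed_def zero_fun_def)
  have "v = (\<Sum>j\<in>J. block_embed ks j (w j))" unfolding w(1)
    using J R b z by (intro sum.mono_neutral_right) auto
  moreover have "\<forall>j\<in>J. w j \<in> S j" using R b J by (metis lessThan_iff subsetD)
  ultimately show "v \<in> block_sum ks J S" by (auto simp: block_sum_def)
qed

section \<open>Systems and their rank function\<close>

locale scalar_extension =
  fixes emb :: "'f::{field,finite} \<Rightarrow> 'K::{field,finite}"
  assumes emb: "field_embedding emb"
begin

sublocale F: finite_scalars "escale emb"
  using vector_space_pointwise[OF vector_space_emb[OF emb]] by (simp add: finite_scalars_def)

sublocale FK: finite_scalars "emb_mult emb"
  using vector_space_emb[OF emb] by (simp add: finite_scalars_def)

sublocale K: finite_scalars "fscale :: 'K \<Rightarrow> (nat \<Rightarrow> 'K) \<Rightarrow> (nat \<Rightarrow> 'K)"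
  using vector_space_pointwise[OF vector_space_mult] by (simp add: finite_scalars_def)

sublocale KK: finite_scalars "(*) :: 'K \<Rightarrow> 'K \<Rightarrow> 'K"
  using vector_space_mult by (simp add: finite_scalars_def)

lemma escale_eq: "escale emb c v = fscale (emb c) v"
  by (simp add: pointwise_def emb_mult_def)

lemma F_subspace_if_K_subspace: "K.subspace V \<Longrightarrow> F.subspace V"
  by (rule F.subspaceI) (auto simp: escale_eq K.subspace_0 K.subspace_add K.subspace_scale)

lemma K_span_F_span: "K.span (F.span B) = K.span B"
proof (rule antisym)
  have "F.span B \<subseteq> K.span B"
    by (rule F.span_minimal) (auto simp: K.span_superset F_subspace_if_K_subspace)
  then show "K.span (F.span B) \<subseteq> K.span B" by (rule K.span_minimal) simp
  show "K.span B \<subseteq> K.span (F.span B)" by (rule K.span_mono[OF F.span_superset])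
qed

lemma F_linear_if_K_linear:
  assumes "Vector_Spaces.linear fscale (*) \<phi>"
  shows "Vector_Spaces.linear (escale emb) (emb_mult emb) \<phi>"
  using assms F.vector_space_axioms FK.vector_space_axioms
  by (auto simp: Vector_Spaces.linear_iff escale_eq emb_mult_def)

lemma K_dim_span_le_F_dim:
  assumes "F.subspace V" "finite V"
  shows "K.dim (K.span V) \<le> F.dim V"
proof -
  obtain B where B: "B \<subseteq> V" "F.independent B" "V \<subseteq> F.span B" "card B = F.dim V"
    by (rule F.basis_exists[of V])
  have "F.span B = V" using B assms by (intro F.span_subspace) auto
  then have "K.span V = K.span B" using K_span_F_span by metis
  then show ?thesis
    using K.dim_le_card[of "K.span V" B] B finite_subset[OF B(1) assms(2)] by auto
qed

text \<open>
  The submodular inequality comes from \<open>span (A + B) = span A + span B\<close> and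
  \<open>span (A \<inter> B) \<subseteq> span A \<inter> span B\<close> together with the modular law over the large field.
\<close>

lemma q_matroid_sys_rank:
  assumes T: "F.subspace T" "finite T" "T \<subseteq> vecs k"
  shows "q_matroid (escale emb) (T, sys_rank)"
proof -
  have fin: "finite V" if "V \<subseteq> T" for V using that T finite_subset by blast
  have sp: "K.span V \<subseteq> vecs k" if "V \<subseteq> T" for V
    using that T by (intro K.span_minimal vecs_subspace[OF vector_space_mult]) auto
  have fsp: "finite (K.span V)" if "V \<subseteq> T" for V
    using finite_subset[OF sp[OF that] finite_vecs] .
  have mono: "sys_rank A \<le> sys_rank B" if "A \<subseteq> B" "B \<subseteq> T" for A B
    unfolding sys_rank_def
    using K.dim_mono_subspace[OF K.subspace_span K.subspace_span fsp[OF that(2)] K.span_mono[OF that(1)]]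
    by (simp only: of_nat_le_iff)
  have "sys_rank {a + b |a b. a \<in> A \<and> b \<in> B} + sys_rank (A \<inter> B) \<le> sys_rank A + sys_rank B"
    if A: "F.subspace A" "A \<subseteq> T" and B: "F.subspace B" "B \<subseteq> T" for A B
  proof -
    let ?A = "K.span A" and ?B = "K.span B"
    let ?S = "{a + b |a b. a \<in> ?A \<and> b \<in> ?B}"
    have "?S \<subseteq> vecs k"
      using sp[OF A(2)] sp[OF B(2)] K.subspace_add[OF vecs_subspace[OF vector_space_mult]] by blast
    then have fS: "finite ?S" using finite_vecs finite_subset by blast
    have sS: "K.subspace ?S" by (rule K.subspace_sums) auto
    have "K.span {a + b |a b. a \<in> A \<and> b \<in> B} \<subseteq> ?S"
      by (rule K.span_minimal) (use sS K.span_superset[of A] K.span_superset[of B] in blast)+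
    then have 1: "K.dim (K.span {a + b |a b. a \<in> A \<and> b \<in> B}) \<le> K.dim ?S"
      by (intro K.dim_mono_subspace[OF _ sS fS]) auto
    have "K.span (A \<inter> B) \<subseteq> ?A \<inter> ?B" by (simp add: K.span_mono)
    then have 2: "K.dim (K.span (A \<inter> B)) \<le> K.dim (?A \<inter> ?B)"
      using fsp[OF A(2)] by (intro K.dim_mono_subspace K.subspace_inter) auto
    have "K.dim ?S + K.dim (?A \<inter> ?B) = K.dim ?A + K.dim ?B"
      using fsp A B by (intro K.dim_sum_Int) auto
    then show ?thesis using 1 2 unfolding sys_rank_def by linarith
  qed
  moreover have "\<exists>B. finite B \<and> T = F.span B"
    using T by (intro exI[of _ T]) (simp add: F.span_eq_iff[THEN iffD2])
  moreover have "sys_rank A \<le> int (F.dim A)" if "F.subspace A" "A \<subseteq> T" for A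
    using K_dim_span_le_F_dim[OF that(1) fin[OF that(2)]] unfolding sys_rank_def
    by (simp only: of_nat_le_iff)
  moreover have "0 \<le> sys_rank A" for A :: "(nat \<Rightarrow> 'K) set" by (simp add: sys_rank_def)
  ultimately show ?thesis unfolding q_matroid_def subspaces_of_def using mono by auto
qed

lemma exists_functional:
  assumes U: "K.subspace U" and x: "x \<notin> U"
  obtains \<phi> :: "(nat \<Rightarrow> 'K) \<Rightarrow> 'K" where "Vector_Spaces.linear fscale (*) \<phi>" "\<And>u. u \<in> U \<Longrightarrow> \<phi> u = 0" "\<phi> x \<noteq> 0"
proof -
  interpret vector_space_pair "fscale :: 'K \<Rightarrow> (nat \<Rightarrow> 'K) \<Rightarrow> _" "(*) :: 'K \<Rightarrow> 'K \<Rightarrow> 'K" ..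
  obtain B where B: "B \<subseteq> U" "K.independent B" "U \<subseteq> K.span B"
    by (rule K.basis_exists[of U])
  have sB: "K.span B = U" using B U by (intro K.span_subspace) auto
  have "K.independent (insert x B)" using B sB x by (intro K.independent_insertI) auto
  then obtain \<phi> where \<phi>: "Vector_Spaces.linear fscale (*) \<phi>"
    "\<And>y. y \<in> insert x B \<Longrightarrow> \<phi> y = (if y = x then 1 else 0)"
    using linear_independent_extend[of "insert x B" "\<lambda>y. if y = x then 1 else (0::'K)"] by blast
  interpret \<phi>: Vector_Spaces.linear "fscale" "(*)" \<phi> by (rule \<phi>(1))
  have "\<phi> u = 0" if "u \<in> U" for u
  proof (rule \<phi>.eq_0_on_span[of B])
    show "u \<in> K.span B" using that sB by simp
    fix b assume "b \<in> B" then show "\<phi> b = 0" using \<phi>(2)[of b] B(1) x by auto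
  qed
  then show thesis using \<phi>(2)[of x] by (intro that[OF \<phi>(1)]) auto
qed

end

locale block_system = scalar_extension emb
  for emb :: "'f::{field,finite} \<Rightarrow> 'K::{field,finite}" +
  fixes t :: nat and ks ns :: "nat \<Rightarrow> nat" and S :: "nat \<Rightarrow> (nat \<Rightarrow> 'K) set"
  assumes system: "\<And>i. i < t \<Longrightarrow> is_system emb (ns i) (ks i) (S i)"
    and ks_pos: "\<And>i. i < t \<Longrightarrow> 1 \<le> ks i" and ks_le_ns: "\<And>i. i < t \<Longrightarrow> ks i \<le> ns i"
begin

abbreviation k :: nat where "k \<equiv> sum ks {..<t}"
abbreviation n :: nat where "n \<equiv> sum ns {..<t}"
abbreviation SJ :: "nat set \<Rightarrow> (nat \<Rightarrow> 'K) set" where "SJ J \<equiv> block_sum ks J S"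
abbreviation VJ :: "nat set \<Rightarrow> (nat \<Rightarrow> 'K) set" where "VJ J \<equiv> block_sum ks J (\<lambda>i. vecs (ks i))"
abbreviation Ssum :: "(nat \<Rightarrow> 'K) set" where "Ssum \<equiv> SJ {..<t}"

definition block_bounded :: "(nat \<Rightarrow> 'K) set \<Rightarrow> bool" where
  "block_bounded I \<longleftrightarrow> (\<forall>J\<subseteq>{..<t}. F.dim (I \<inter> SJ J) \<le> sum ks J)"

lemma S_subspace: "i < t \<Longrightarrow> F.subspace (S i)"
  and S_vecs: "i < t \<Longrightarrow> S i \<subseteq> vecs (ks i)"
  and S_dim: "i < t \<Longrightarrow> F.dim (S i) = ns i"
  and S_span: "i < t \<Longrightarrow> K.span (S i) = vecs (ks i)"
  using system by (auto simp: is_system_def)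

lemma SJ_iff: "J \<subseteq> {..<t} \<Longrightarrow> v \<in> SJ J \<longleftrightarrow> v \<in> Ssum \<and> (\<forall>i\<in>{..<t} - J. block_part ks i v = 0)"
proof -
  assume J: "J \<subseteq> {..<t}"
  have 1: "v \<in> SJ J \<longleftrightarrow> v \<in> vecs k \<and> (\<forall>i\<in>J. block_part ks i v \<in> S i) \<and>
    (\<forall>i\<in>{..<t} - J. block_part ks i v = 0)"
    using J S_vecs by (intro block_sum_iff) auto
  have 2: "v \<in> Ssum \<longleftrightarrow> v \<in> vecs k \<and> (\<forall>i\<in>{..<t}. block_part ks i v \<in> S i) \<and>
    (\<forall>i\<in>{..<t} - {..<t}. block_part ks i v = 0)"
    using S_vecs by (intro block_sum_iff) auto
  show ?thesis unfolding 1 2 using J F.subspace_0[OF S_subspace] by (metis Diff_cancel Diff_iff empty_iff lessThan_iff subsetD)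
qed

lemma SJ_subspace: "J \<subseteq> {..<t} \<Longrightarrow> F.subspace (SJ J)"
  using S_subspace by (intro block_sum_subspace[OF FK.vector_space_axioms]) auto

lemma SJ_finite: "J \<subseteq> {..<t} \<Longrightarrow> finite (SJ J)"
  using S_vecs finite_subset[of J "{..<t}"] by (intro finite_block_sum) auto

lemma SJ_dim: "J \<subseteq> {..<t} \<Longrightarrow> F.dim (SJ J) = sum ns J"
proof -
  assume J: "J \<subseteq> {..<t}"
  have "F.dim (SJ J) = (\<Sum>j\<in>J. F.dim (S j))"
    using J S_subspace S_vecs finite_subset[OF J]
    by (intro dim_block_sum[OF FK.vector_space_axioms]) auto
  also have "\<dots> = sum ns J" using J S_dim by (intro sum.cong) auto
  finally show ?thesis .
qed

lemma SJ_Ssum: "J \<subseteq> {..<t} \<Longrightarrow> SJ J \<subseteq> Ssum"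
  using SJ_iff by auto

lemma SJ_Int: "J \<subseteq> {..<t} \<Longrightarrow> J' \<subseteq> {..<t} \<Longrightarrow> SJ J \<inter> SJ J' = SJ (J \<inter> J')"
  using SJ_iff[of J] SJ_iff[of J'] SJ_iff[of "J \<inter> J'"] by blast

lemma SJ_mono: "J \<subseteq> J' \<Longrightarrow> J' \<subseteq> {..<t} \<Longrightarrow> SJ J \<subseteq> SJ J'"
  using SJ_Int[of J J'] by (metis Int_absorb2 inf_le2 order_trans)

lemma VJ_subspace: "K.subspace (VJ J)"
  by (rule block_sum_subspace[OF vector_space_mult vecs_subspace[OF vector_space_mult]])

lemma VJ_finite: "J \<subseteq> {..<t} \<Longrightarrow> finite (VJ J)"
  using finite_subset[of J "{..<t}"] by (intro finite_block_sum) auto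

lemma VJ_dim: "J \<subseteq> {..<t} \<Longrightarrow> K.dim (VJ J) = sum ks J"
  using finite_subset[of J "{..<t}"]
  by (subst dim_block_sum[OF vector_space_mult]) (auto simp: vecs_subspace[OF vector_space_mult] dim_vecs)

lemma SJ_VJ: "J \<subseteq> {..<t} \<Longrightarrow> SJ J \<subseteq> VJ J"
  using S_vecs by (intro block_sum_mono) auto

lemma Ssum_vecs: "Ssum \<subseteq> vecs k"
  using SJ_VJ[of "{..<t}"] by (simp add: block_sum_vecs)

lemma block_embed_Ssum: "i < t \<Longrightarrow> v \<in> S i \<Longrightarrow> block_embed ks i v \<in> Ssum"
proof -
  assume i: "i < t" "v \<in> S i"
  have "(\<Sum>j<t. block_embed ks j (if j = i then v else 0)) = (\<Sum>j<t. if j = i then block_embed ks i v else 0)"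
    by (intro sum.cong) (auto simp: block_embed_def fun_eq_iff)
  also have "\<dots> = block_embed ks i v" using i by simp
  finally show ?thesis using i F.subspace_0[OF S_subspace]
    unfolding block_sum_def by (intro CollectI exI[of _ "\<lambda>j. if j = i then v else 0"]) auto
qed

lemma Ssum_span: "K.span Ssum = vecs k"
proof
  show "K.span Ssum \<subseteq> vecs k"
    by (rule K.span_minimal[OF Ssum_vecs vecs_subspace[OF vector_space_mult]])
  have e: "block_embed ks i v \<in> K.span Ssum" if "i < t" "v \<in> vecs (ks i)" for i v
  proof -
    interpret b: Vector_Spaces.linear fscale fscale "block_embed ks i"
      by (rule linear_block_embed[OF vector_space_mult])
    have "block_embed ks i v \<in> block_embed ks i ` K.span (S i)" using that S_span by auto
    also have "\<dots> = K.span (block_embed ks i ` S i)" by (rule b.span_image[symmetric])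
    also have "\<dots> \<subseteq> K.span Ssum" using block_embed_Ssum[OF that(1)] by (intro K.span_mono) auto
    finally show ?thesis .
  qed
  have "VJ {..<t} \<subseteq> K.span Ssum"
  proof
    fix x :: "nat \<Rightarrow> 'K" assume "x \<in> VJ {..<t}"
    then obtain v where x: "x = (\<Sum>j<t. block_embed ks j (v j))" and v: "\<forall>j\<in>{..<t}. v j \<in> vecs (ks j)"
      by (auto simp: block_sum_def)
    show "x \<in> K.span Ssum" unfolding x using v by (intro K.span_sum e) auto
  qed
  then show "vecs k \<subseteq> K.span Ssum" by (simp add: block_sum_vecs)
qed

lemma is_system_Ssum: "is_system emb n k Ssum"
  using SJ_subspace[of "{..<t}"] Ssum_vecs SJ_dim[of "{..<t}"] Ssum_span by (simp add: is_system_def)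

lemma q_matroid_Ssum: "q_matroid (escale emb) (Ssum, sys_rank)"
  using q_matroid_sys_rank[OF SJ_subspace SJ_finite Ssum_vecs] by simp

lemma block_bounded_if_indep:
  assumes I: "F.subspace I" "I \<subseteq> Ssum" and ind: "sys_rank I = int (F.dim I)"
  shows "block_bounded I"
  unfolding block_bounded_def
proof (intro allI impI)
  fix J assume J: "J \<subseteq> {..<t}"
  have "sys_rank (I \<inter> SJ J) = int (F.dim (I \<inter> SJ J))"
    using I SJ_subspace[OF J]
    by (intro F.qm_indep_subspace[OF q_matroid_Ssum SJ_finite _ I(1) _ I(2) ind] F.subspace_inter) auto
  moreover have "K.dim (K.span (I \<inter> SJ J)) \<le> K.dim (VJ J)"
    using SJ_VJ[OF J] by (intro K.dim_mono_subspace K.span_minimal VJ_subspace VJ_finite[OF J]) auto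
  ultimately show "F.dim (I \<inter> SJ J) \<le> sum ks J" using VJ_dim[OF J] by (simp only: sys_rank_def of_nat_eq_iff)
qed

end

section \<open>Block-bounded subspaces and evasiveness\<close>

context block_system
begin

text \<open>
  A minimal \<open>J\<close> makes every \<open>SJ J' \<inter> H\<close> with \<open>J'\<close> nonempty and properly inside \<open>J\<close> small, which is what
  block-boundedness of a \<open>k_J\<close>-dimensional \<open>I\<close> requires.  Minimality is taken with respect to cardinality.
\<close>

lemma evasive_if_block_bounded_indep:
  assumes P2: "\<And>I. F.subspace I \<Longrightarrow> I \<subseteq> Ssum \<Longrightarrow> block_bounded I \<Longrightarrow> sys_rank I = int (F.dim I)"
    and H: "H \<in> Lambda (k - 1) t ks" and t: "1 \<le> t"
  shows "F.dim (Ssum \<inter> H) \<le> k - 1"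
proof (rule ccontr)
  assume "\<not> F.dim (Ssum \<inter> H) \<le> k - 1"
  have H': "K.subspace H" "\<And>i. i < t \<Longrightarrow> \<not> block_embed ks i ` vecs (ks i) \<subseteq> H"
    using H by (auto simp: Lambda_def subspaces_of_def)
  note FH = F_subspace_if_K_subspace[OF H'(1)]
  let ?P = "\<lambda>J. J \<subseteq> {..<t} \<and> J \<noteq> {} \<and> sum ks J \<le> F.dim (SJ J \<inter> H)"
  have "?P {..<t}" using t \<open>\<not> F.dim (Ssum \<inter> H) \<le> k - 1\<close> by (auto simp: lessThan_empty_iff)
  then obtain J where J: "?P J" and min: "\<And>J'. ?P J' \<Longrightarrow> card J \<le> card J'"
    using ex_has_least_nat[of ?P "{..<t}" card] by blast
  have fJ: "finite J" using J finite_subset by blast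
  have sH: "F.subspace (SJ J' \<inter> H)" "finite (SJ J' \<inter> H)" if "J' \<subseteq> {..<t}" for J'
    using SJ_subspace[OF that] SJ_finite[OF that] FH by (auto intro: F.subspace_inter)
  obtain I where I: "F.subspace I" "I \<subseteq> SJ J \<inter> H" "F.dim I = sum ks J"
    using F.exists_subspace_of_dim[OF sH, of J "sum ks J"] J by blast
  have fI: "finite I" using I(2) sH(2)[of J] J finite_subset by blast
  have "block_bounded I" unfolding block_bounded_def
  proof (intro allI impI)
    fix J' assume J': "J' \<subseteq> {..<t}"
    have sI: "F.subspace (I \<inter> SJ J')" by (rule F.subspace_inter[OF I(1) SJ_subspace[OF J']])
    have sub: "I \<inter> SJ J' \<subseteq> SJ (J \<inter> J') \<inter> H" using I(2) SJ_Int[of J J'] J J' by blast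
    have JJ: "J \<inter> J' \<subseteq> {..<t}" using J' by auto
    have fJ': "finite J'" using J' finite_subset by blast
    have le: "sum ks (J \<inter> J') \<le> sum ks J'" using fJ' by (intro sum_mono2) auto
    consider "J \<inter> J' = {}" | "J \<subseteq> J'" | "J \<inter> J' \<noteq> {}" "J \<inter> J' \<subset> J" by blast
    then show "F.dim (I \<inter> SJ J') \<le> sum ks J'"
    proof cases
      case 1
      have "SJ {} = {0}" by (simp add: block_sum_def)
      then have "I \<inter> SJ J' = {0}" using sub 1 F.subspace_0[OF sI] by auto
      then show ?thesis by simp
    next
      case 2
      have "F.dim (I \<inter> SJ J') \<le> F.dim I" by (rule F.dim_mono_subspace[OF sI I(1) fI]) auto
      also have "\<dots> \<le> sum ks J'" unfolding I(3) using 2 fJ' by (intro sum_mono2) auto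
      finally show ?thesis .
    next
      case 3
      have "card (J \<inter> J') < card J" using 3 fJ by (intro psubset_card_mono) auto
      then have "\<not> ?P (J \<inter> J')" using min[of "J \<inter> J'"] by linarith
      then have "F.dim (SJ (J \<inter> J') \<inter> H) < sum ks (J \<inter> J')" using 3 JJ by auto
      moreover have "F.dim (I \<inter> SJ J') \<le> F.dim (SJ (J \<inter> J') \<inter> H)"
        by (rule F.dim_mono_subspace[OF sI sH[OF JJ] sub])
      ultimately show ?thesis using le by linarith
    qed
  qed
  then have "sys_rank I = int (sum ks J)"
    using P2[OF I(1)] I(2,3) SJ_Ssum[of J] J by auto
  then have r: "K.dim (K.span I) = sum ks J" by (simp only: sys_rank_def of_nat_eq_iff)
  have sub: "K.span I \<subseteq> VJ J" "K.span I \<subseteq> H"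
    by (rule K.span_minimal[OF _ VJ_subspace], use I(2) SJ_VJ[of J] J in blast)
      (rule K.span_minimal[OF _ H'(1)], use I(2) in blast)
  have "K.span I = VJ J"
    using J r VJ_dim[of J] sub(1) by (intro K.dim_eq_imp_eq VJ_subspace VJ_finite) auto
  then have VH: "VJ J \<subseteq> H" using sub by simp
  obtain i where i: "i \<in> J" using J by blast
  have "block_embed ks i v \<in> VJ J" if "v \<in> vecs (ks i)" for v :: "nat \<Rightarrow> 'K"
    using i J that block_part_embed[where ks = ks and i = i, OF that] block_embed_in_vecs[of i t ks v] block_part_in_vecs
      K.subspace_0[OF vecs_subspace[OF vector_space_mult]]
    by (subst block_sum_iff[of J _ ks t]) auto
  then show False using H'(2)[of i] VH i J by auto
qed

text \<open>
  The sets \<open>J\<close> for which the bound is attained are closed under union, by the modular law, so there is a largest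
  one, \<open>M\<close>.  Adjoining \<open>x\<close> can violate only attained bounds, and only if \<open>x \<in> I + SJ M\<close>.  Since \<open>ks i \<le> ns i\<close>,
  the subspace \<open>I + SJ M\<close> is too small to be all of \<open>Ssum\<close>.
\<close>

lemma block_bounded_insert:
  assumes I: "F.subspace I" "I \<subseteq> Ssum" "block_bounded I" "F.dim I < k"
  shows "\<exists>x. x \<in> Ssum \<and> x \<notin> I \<and> block_bounded (F.span (insert x I))"
proof -
  let ?sum = "\<lambda>A B. {a + b |a b. a \<in> A \<and> b \<in> B}"
  have fI: "finite I" using I(2) SJ_finite[of "{..<t}"] finite_subset by blast
  have sI: "F.subspace (I \<inter> SJ J)" if "J \<subseteq> {..<t}" for J
    using F.subspace_inter[OF I(1) SJ_subspace[OF that]] .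
  have le: "F.dim (I \<inter> SJ J) \<le> sum ks J" if "J \<subseteq> {..<t}" for J
    using I(3) that by (simp add: block_bounded_def)
  let ?tight = "\<lambda>J. J \<subseteq> {..<t} \<and> F.dim (I \<inter> SJ J) = sum ks J"
  have un: "?tight (J \<union> J')" if "?tight J" "?tight J'" for J J'
  proof -
    have J: "J \<subseteq> {..<t}" "J' \<subseteq> {..<t}" "J \<union> J' \<subseteq> {..<t}" "J \<inter> J' \<subseteq> {..<t}" using that by auto
    have "?sum (I \<inter> SJ J) (I \<inter> SJ J') \<subseteq> I \<inter> SJ (J \<union> J')"
      using SJ_mono[of J "J \<union> J'"] SJ_mono[of J' "J \<union> J'"] J
        F.subspace_add[OF I(1)] F.subspace_add[OF SJ_subspace[OF J(3)]] by blast
    then have 1: "F.dim (?sum (I \<inter> SJ J) (I \<inter> SJ J')) \<le> F.dim (I \<inter> SJ (J \<union> J'))"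
      using fI by (intro F.dim_mono_subspace F.subspace_sums sI J) auto
    have "F.dim (?sum (I \<inter> SJ J) (I \<inter> SJ J')) + F.dim ((I \<inter> SJ J) \<inter> (I \<inter> SJ J')) =
        F.dim (I \<inter> SJ J) + F.dim (I \<inter> SJ J')"
      using fI by (intro F.dim_sum_Int sI J) auto
    moreover have "(I \<inter> SJ J) \<inter> (I \<inter> SJ J') = I \<inter> SJ (J \<inter> J')" using SJ_Int[OF J(1,2)] by blast
    moreover have "sum ks (J \<union> J') + sum ks (J \<inter> J') = sum ks J + sum ks J'"
      using J(1,2) finite_subset[of _ "{..<t}"] by (intro sum.union_inter) auto
    ultimately have "sum ks (J \<union> J') \<le> F.dim (I \<inter> SJ (J \<union> J'))"
      using 1 le[OF J(4)] that by simp
    then show ?thesis using le[OF J(3)] J(3) by simp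
  qed
  have "?tight {}" using le[of "{}"] by simp
  moreover have "\<forall>J. ?tight J \<longrightarrow> card J < Suc t"
    using card_mono[of "{..<t}"] by (auto simp: less_Suc_eq_le)
  ultimately have "\<exists>J. ?tight J \<and> (\<forall>J'. ?tight J' \<longrightarrow> card J' \<le> card J)"
    by (rule Lattices_Big.ex_has_greatest_nat)
  then obtain M where M: "?tight M" and max: "\<And>J'. ?tight J' \<Longrightarrow> card J' \<le> card M" by auto
  have Mt: "M \<subseteq> {..<t}" and fM: "finite M" using M finite_subset by auto
  have top: "J \<subseteq> M" if "?tight J" for J
  proof -
    have "finite (M \<union> J)" using M that finite_subset[of _ "{..<t}"] by blast
    moreover have "card (M \<union> J) \<le> card M" using max[OF un[OF M that]] .
    ultimately have "M = M \<union> J" by (intro card_seteq) auto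
    then show ?thesis by blast
  qed
  let ?W = "?sum I (SJ M)"
  have "F.dim ?W + F.dim (I \<inter> SJ M) = F.dim I + F.dim (SJ M)"
    using fI SJ_finite[OF Mt] by (intro F.dim_sum_Int I SJ_subspace[OF Mt]) auto
  then have "F.dim ?W + sum ks M < k + sum ns M"
    using M I(4) SJ_dim[OF Mt] by linarith
  moreover have "k = sum ks M + sum ks ({..<t} - M)" "n = sum ns M + sum ns ({..<t} - M)"
    using Mt by (metis add.commute finite_lessThan sum.subset_diff)+
  moreover have "sum ks ({..<t} - M) \<le> sum ns ({..<t} - M)"
    by (intro sum_mono ks_le_ns) auto
  ultimately have dW: "F.dim ?W < n" by linarith
  have sW: "F.subspace ?W" by (rule F.subspace_sums[OF I(1) SJ_subspace[OF Mt]])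
  have "\<not> Ssum \<subseteq> ?W"
  proof
    assume "Ssum \<subseteq> ?W"
    have "?W \<subseteq> Ssum" using I(2) SJ_Ssum[OF Mt] F.subspace_add[OF SJ_subspace[of "{..<t}"]] by blast
    then have "finite ?W" using SJ_finite[of "{..<t}"] finite_subset by blast
    then have "F.dim Ssum \<le> F.dim ?W"
      using \<open>Ssum \<subseteq> ?W\<close> by (intro F.dim_mono_subspace SJ_subspace sW) auto
    then show False using dW SJ_dim[of "{..<t}"] by simp
  qed
  then obtain x where x: "x \<in> Ssum" "x \<notin> ?W" by blast
  have IW: "I \<subseteq> ?W"
  proof
    fix a assume "a \<in> I"
    then show "a \<in> ?W" using F.subspace_0[OF SJ_subspace[OF Mt]]
      by (intro CollectI exI[of _ a] exI[of _ 0]) auto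
  qed
  then have xI: "x \<notin> I" using x by blast
  let ?I = "F.span (insert x I)"
  have dI: "F.dim ?I = Suc (F.dim I)" by (rule F.dim_span_insert[OF I(1) fI xI])
  have fI': "finite ?I" by (rule F.finite_span_insert[OF I(1) fI])
  have II: "I \<subseteq> ?I" using F.span_superset[of "insert x I"] by blast
  have "F.dim (?I \<inter> SJ J) \<le> sum ks J" if J: "J \<subseteq> {..<t}" for J
  proof (cases "?tight J")
    case True
    have "?I \<inter> SJ J \<subseteq> I \<inter> SJ J"
    proof
      fix y assume y: "y \<in> ?I \<inter> SJ J"
      then obtain c where c: "y - escale emb c x \<in> I"
        using I(1) by (auto simp: F.span_breakdown_eq F.span_eq_iff[THEN iffD2])
      have "c = 0"
      proof (rule ccontr)
        assume "c \<noteq> 0"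
        have "y \<in> SJ M" using y SJ_mono[OF top[OF True] Mt] by blast
        moreover have "- (y - escale emb c x) \<in> I" using c I(1) F.subspace_neg by blast
        moreover have "escale emb c x = - (y - escale emb c x) + y" by simp
        ultimately have "escale emb c x \<in> ?W" by blast
        then have "escale emb (inverse c) (escale emb c x) \<in> ?W" by (rule F.subspace_scale[OF sW])
        then show False using x(2) \<open>c \<noteq> 0\<close> by simp
      qed
      then show "y \<in> I \<inter> SJ J" using c y by simp
    qed
    then have "F.dim (?I \<inter> SJ J) \<le> F.dim (I \<inter> SJ J)"
      using fI by (intro F.dim_mono_subspace F.subspace_inter SJ_subspace[OF J] I) auto
    then show ?thesis using le[OF J] by simp
  next
    case False
    then have lt: "F.dim (I \<inter> SJ J) < sum ks J" using le[OF J] J by force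
    have s: "F.subspace (?I \<inter> SJ J)" "finite (?I \<inter> SJ J)"
      using fI' F.subspace_inter[OF F.subspace_span SJ_subspace[OF J]] by auto
    have "F.dim (?sum (?I \<inter> SJ J) I) + F.dim ((?I \<inter> SJ J) \<inter> I) = F.dim (?I \<inter> SJ J) + F.dim I"
      by (rule F.dim_sum_Int[OF s I(1) fI])
    moreover have "(?I \<inter> SJ J) \<inter> I = I \<inter> SJ J" using II by blast
    moreover have "F.dim (?sum (?I \<inter> SJ J) I) \<le> F.dim ?I"
    proof (rule F.dim_mono_subspace[OF F.subspace_sums[OF s(1) I(1)] F.subspace_span fI'])
      show "?sum (?I \<inter> SJ J) I \<subseteq> ?I" using II F.span_add by blast
    qed
    ultimately show ?thesis using lt dI by simp
  qed
  then show ?thesis using x xI by (auto simp: block_bounded_def)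
qed

lemma block_bounded_extend:
  assumes "F.subspace I" "I \<subseteq> Ssum" "block_bounded I"
  shows "\<exists>I'. F.subspace I' \<and> I \<subseteq> I' \<and> I' \<subseteq> Ssum \<and> block_bounded I' \<and> F.dim I' = k"
  using assms
proof (induction "k - F.dim I" arbitrary: I rule: less_induct)
  case less
  have fI: "finite I" using less.prems(2) SJ_finite[of "{..<t}"] finite_subset by blast
  have "F.dim (I \<inter> Ssum) \<le> k" using less.prems(3) by (auto simp: block_bounded_def)
  then have "F.dim I \<le> k" using less.prems(2) by (simp add: Int_absorb2)
  show ?case
  proof (cases "F.dim I = k")
    case False
    then have lt: "F.dim I < k" using \<open>F.dim I \<le> k\<close> by simp
    obtain x where x: "x \<in> Ssum" "x \<notin> I" "block_bounded (F.span (insert x I))"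
      using block_bounded_insert[OF less.prems lt] by blast
    let ?I = "F.span (insert x I)"
    have "F.dim ?I = Suc (F.dim I)" by (rule F.dim_span_insert[OF less.prems(1) fI x(2)])
    then have "k - F.dim ?I < k - F.dim I" using lt by simp
    moreover have "?I \<subseteq> Ssum" using x less.prems by (intro F.span_minimal SJ_subspace) auto
    ultimately obtain I' where "F.subspace I'" "?I \<subseteq> I'" "I' \<subseteq> Ssum" "block_bounded I'" "F.dim I' = k"
      using less.hyps[of ?I] x(3) F.subspace_span by blast
    then show ?thesis using F.span_superset[of "insert x I"] by blast
  qed (use less.prems in blast)
qed

text \<open>
  The blocks that lie in the kernel of \<open>\<phi>\<close>.  The kernel of a nonzero \<open>\<phi>\<close> is a hyperplane without full blocks exactly when there are none.
\<close>

definition dead_blocks :: "((nat \<Rightarrow> 'K) \<Rightarrow> 'K) \<Rightarrow> nat set" where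
  "dead_blocks \<phi> = {i. i < t \<and> (\<forall>v\<in>vecs (ks i). \<phi> (block_embed ks i v) = 0)}"

text \<open>
  If no block is dead, the claim is the evasiveness of \<open>Ssum\<close> for the hyperplane \<open>ker \<phi>\<close>, by rank-nullity.
  Reviving a dead block \<open>i\<close> changes \<open>k_D\<close> and \<open>n_D\<close> by \<open>k_i\<close> and \<open>n_i\<close>, so the dimension of the image may
  increase by at most \<open>n_i - k_i\<close>.  A suitable functional on block \<open>i\<close> has an image of dimension at most
  \<open>n_i - k_i + 1\<close>, and the extra dimension is saved by making the two images intersect.
\<close>

lemma functional_image_dim:
  assumes ev: "evasive emb (Lambda (k - 1) t ks) (k - 1) Ssum"
    and \<phi>: "Vector_Spaces.linear fscale (*) \<phi>" and nz: "\<exists>v\<in>vecs k. \<phi> v \<noteq> 0"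
  shows "n + sum ks (dead_blocks \<phi>) < FK.dim (\<phi> ` Ssum) + k + sum ns (dead_blocks \<phi>)"
  using \<phi> nz
proof (induction "card (dead_blocks \<phi>)" arbitrary: \<phi> rule: less_induct)
  case less
  note \<phi> = less.prems(1)
  interpret \<phi>: Vector_Spaces.linear fscale "(*)" \<phi> by (rule \<phi>)
  have F\<phi>: "Vector_Spaces.linear (escale emb) (emb_mult emb) \<phi>" by (rule F_linear_if_K_linear[OF \<phi>])
  interpret F\<phi>: Vector_Spaces.linear "escale emb" "emb_mult emb" \<phi> by (rule F\<phi>)
  have sSS: "F.subspace Ssum" and fSS: "finite Ssum" and dSS: "F.dim Ssum = n"
    using SJ_subspace[of "{..<t}"] SJ_finite[of "{..<t}"] SJ_dim[of "{..<t}"] by auto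
  show ?case
  proof (cases "dead_blocks \<phi> = {}")
    case True
    let ?H = "{v \<in> vecs k. \<phi> v = 0}"
    have sH: "K.subspace ?H"
      using K.subspace_inter[OF vecs_subspace[OF vector_space_mult] \<phi>.subspace_kernel] by (simp add: Int_def)
    have "k = K.dim ?H + KK.dim (\<phi> ` vecs k)"
      using dim_kernel_image[OF \<phi> vecs_subspace[OF vector_space_mult] finite_vecs, of k] unfolding dim_vecs .
    moreover have "KK.dim (\<phi> ` vecs k) = 1"
    proof -
      have "x \<in> KK.span {1}" for x :: 'K by (simp add: KK.span_singleton image_iff)
      then have "KK.dim (\<phi> ` vecs k) \<le> 1" using KK.dim_le_card[of "\<phi> ` vecs k" "{1}"] by auto
      moreover have "KK.dim (\<phi> ` vecs k) \<noteq> 0"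
        using KK.dim_eq_0_imp[OF \<phi>.subspace_image[OF vecs_subspace[OF vector_space_mult]], of k] less.prems(2)
        by auto
      ultimately show ?thesis by simp
    qed
    ultimately have k: "K.dim ?H = k - 1" "1 \<le> k" by linarith+
    have "?H \<in> Lambda (k - 1) t ks"
      using sH True k by (auto simp: Lambda_def subspaces_of_def dead_blocks_def)
    then have "F.dim (Ssum \<inter> ?H) \<le> k - 1" using ev by (auto simp: evasive_def)
    moreover have "F.dim (Ssum \<inter> ?H) = F.dim {v \<in> Ssum. \<phi> v = 0}"
      using Ssum_vecs by (intro arg_cong[of _ _ F.dim]) auto
    moreover have "n = F.dim {v \<in> Ssum. \<phi> v = 0} + FK.dim (\<phi> ` Ssum)"
      using dim_kernel_image[OF F\<phi> sSS fSS] unfolding dSS .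
    ultimately have "n < FK.dim (\<phi> ` Ssum) + k" using k(2) by linarith
    then show ?thesis using True by simp
  next
    case False
    then obtain i where i: "i \<in> dead_blocks \<phi>" by blast
    then have it: "i < t" by (simp add: dead_blocks_def)
    note Si = S_subspace[OF it] finite_subset[OF S_vecs[OF it] finite_vecs]
    have "ks i - 1 \<le> F.dim (S i)" using ks_le_ns[OF it] S_dim[OF it] by linarith
    then obtain T where T: "F.subspace T" "T \<subseteq> S i" "F.dim T = ks i - 1"
      using F.exists_subspace_of_dim[OF Si] by blast
    have fT: "finite T" using T(2) Si(2) finite_subset by blast
    have "K.dim (K.span T) < ks i"
      using K_dim_span_le_F_dim[OF T(1) fT] T(3) ks_pos[OF it] by linarith
    then have "K.span T \<noteq> vecs (ks i)" by (metis dim_vecs less_irrefl)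
    moreover have "K.span T \<subseteq> vecs (ks i)"
      using T(2) S_vecs[OF it] by (intro K.span_minimal vecs_subspace[OF vector_space_mult]) auto
    ultimately obtain x where x: "x \<in> vecs (ks i)" "x \<notin> K.span T" by blast
    obtain \<psi> where \<psi>: "Vector_Spaces.linear fscale (*) \<psi>" "\<And>u. u \<in> K.span T \<Longrightarrow> \<psi> u = 0" "\<psi> x \<noteq> (0::'K)"
      using exists_functional[OF K.subspace_span x(2)] by blast
    interpret \<psi>: Vector_Spaces.linear fscale "(*)" \<psi> by (rule \<psi>(1))
    have F\<psi>: "Vector_Spaces.linear (escale emb) (emb_mult emb) \<psi>" by (rule F_linear_if_K_linear[OF \<psi>(1)])
    interpret F\<psi>: Vector_Spaces.linear "escale emb" "emb_mult emb" \<psi> by (rule F\<psi>)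
    have "\<exists>b\<in>S i. \<psi> b \<noteq> 0"
      using \<psi>.eq_0_on_span[of "S i" x] S_span[OF it] x(1) \<psi>(3) by auto
    then obtain b where b: "b \<in> S i" "\<psi> b \<noteq> 0" by blast
    have "\<exists>a\<in>Ssum. \<phi> a \<noteq> 0"
      using \<phi>.eq_0_on_span[of Ssum] Ssum_span less.prems(2) by auto
    then obtain a where a: "a \<in> Ssum" "\<phi> a \<noteq> 0" by blast
    \<comment> \<open>With this factor, \<open>\<phi> a\<close> is a common nonzero value of \<open>\<phi>\<close> and \<open>c * \<psi>\<close>.\<close>
    define c where "c = \<phi> a / \<psi> b"
    have c0: "c \<noteq> 0" using a b by (simp add: c_def)
    define \<phi>' where "\<phi>' v = \<phi> v + c * \<psi> (block_part ks i v)" for v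
    interpret p: Vector_Spaces.linear fscale fscale "block_part ks i"
      by (rule linear_block_part[OF vector_space_mult])
    have lin: "Vector_Spaces.linear fscale (*) \<phi>'"
      unfolding Vector_Spaces.linear_iff
    proof (intro conjI allI K.vector_space_axioms KK.vector_space_axioms)
      fix x y show "\<phi>' (x + y) = \<phi>' x + \<phi>' y"
        unfolding \<phi>'_def \<phi>.add p.add \<psi>.add by (simp only: distrib_left add_ac)
    next
      fix d x show "\<phi>' (fscale d x) = d * \<phi>' x"
        unfolding \<phi>'_def \<phi>.scale p.scale \<psi>.scale by (simp only: distrib_left mult_ac)
    qed
    have emb\<phi>': "\<phi>' (block_embed ks j v) = \<phi> (block_embed ks j v) + (if j = i then c * \<psi> v else 0)"
      if "v \<in> vecs (ks j)" for j v
      unfolding \<phi>'_def block_part_embed[where ks = ks and i = j, OF that] by (simp add: \<psi>.zero)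
    have alive: "\<phi>' (block_embed ks i x) \<noteq> 0"
      using emb\<phi>'[OF x(1)] x(1) i c0 \<psi>(3) by (auto simp: dead_blocks_def)
    have dead: "dead_blocks \<phi>' = dead_blocks \<phi> - {i}"
    proof -
      have "\<forall>j. j \<noteq> i \<longrightarrow> j \<in> dead_blocks \<phi>' \<longleftrightarrow> j \<in> dead_blocks \<phi>"
        using emb\<phi>' by (simp add: dead_blocks_def)
      moreover have "i \<notin> dead_blocks \<phi>'" using alive x(1) by (auto simp: dead_blocks_def)
      ultimately have "j \<in> dead_blocks \<phi>' \<longleftrightarrow> j \<in> dead_blocks \<phi> - {i}" for j
        by (cases "j = i") auto
      then show ?thesis by (rule set_eqI)
    qed
    have fd: "finite (dead_blocks \<phi>)" by (rule finite_subset[of _ "{..<t}"]) (auto simp: dead_blocks_def)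
    from alive have "\<exists>v\<in>vecs k. \<phi>' v \<noteq> 0" using block_embed_in_vecs[OF it, of ks x] by blast
    then have IH: "n + sum ks (dead_blocks \<phi>') < FK.dim (\<phi>' ` Ssum) + k + sum ns (dead_blocks \<phi>')"
      using less.hyps[OF _ lin] dead i fd card_Diff1_less[OF fd i] by simp
    interpret F\<phi>': Vector_Spaces.linear "escale emb" "emb_mult emb" \<phi>' by (rule F_linear_if_K_linear[OF lin])
    let ?A = "\<phi> ` Ssum" and ?C = "(*) c ` \<psi> ` S i"
    have lc: "Vector_Spaces.linear (emb_mult emb) (emb_mult emb) ((*) c)"
      unfolding Vector_Spaces.linear_iff emb_mult_def[abs_def]
      by (intro conjI allI FK.vector_space_axioms[unfolded emb_mult_def[abs_def]])
        (simp_all only: distrib_left mult_ac)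
    interpret lc: Vector_Spaces.linear "emb_mult emb" "emb_mult emb" "(*) c" by (rule lc)
    have sA: "FK.subspace ?A" by (rule F\<phi>.subspace_image[OF sSS])
    have sB: "FK.subspace (\<psi> ` S i)" by (rule F\<psi>.subspace_image[OF Si(1)])
    have sC: "FK.subspace ?C" by (rule lc.subspace_image[OF sB])
    have dC: "FK.dim ?C = FK.dim (\<psi> ` S i)"
      using c0 by (intro dim_image_inj_on[OF lc sB]) (auto intro!: inj_onI)
    \<comment> \<open>The kernel of \<open>\<psi>\<close> on \<open>S i\<close> contains \<open>T\<close>, so its image has dimension at most \<open>ns i - ks i + 1\<close>.\<close>
    have "T \<subseteq> {v \<in> S i. \<psi> v = 0}" using T(2) \<psi>(2) K.span_superset[of T] by auto
    moreover have sk: "F.subspace {v \<in> S i. \<psi> v = 0}"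
      using F.subspace_inter[OF Si(1) F\<psi>.subspace_kernel] by (simp add: Int_def)
    ultimately have "ks i - 1 \<le> F.dim {v \<in> S i. \<psi> v = 0}"
      using F.dim_mono_subspace[OF T(1) sk] Si(2) T(3) by simp
    moreover have "ns i = F.dim {v \<in> S i. \<psi> v = 0} + FK.dim (\<psi> ` S i)"
      using dim_kernel_image[OF F\<psi> Si] unfolding S_dim[OF it] .
    ultimately have dC': "FK.dim ?C + (ks i - 1) \<le> ns i" using dC by linarith
    have aC: "\<phi> a \<in> ?A \<inter> ?C"
    proof -
      have "\<phi> a = c * \<psi> b" using b(2) by (simp add: c_def)
      then show ?thesis using a(1) b(1) by blast
    qed
    have "FK.dim (?A \<inter> ?C) \<noteq> 0"
      using FK.dim_eq_0_imp[OF FK.subspace_inter[OF sA sC]] aC a(2) by auto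
    moreover have "FK.dim {x + y |x y. x \<in> ?A \<and> y \<in> ?C} + FK.dim (?A \<inter> ?C) = FK.dim ?A + FK.dim ?C"
      by (rule FK.dim_sum_Int[OF sA _ sC]) auto
    moreover have "FK.dim (\<phi>' ` Ssum) \<le> FK.dim {x + y |x y. x \<in> ?A \<and> y \<in> ?C}"
    proof (rule FK.dim_mono_subspace[OF F\<phi>'.subspace_image[OF sSS] FK.subspace_sums[OF sA sC]])
      have "block_part ks i v \<in> S i" if "v \<in> Ssum" for v
        using that block_sum_iff[of "{..<t}" S ks t v] S_vecs it by auto
      then show "\<phi>' ` Ssum \<subseteq> {x + y |x y. x \<in> ?A \<and> y \<in> ?C}"
        unfolding \<phi>'_def by blast
    qed simp
    ultimately have "FK.dim (\<phi>' ` Ssum) + ks i \<le> FK.dim ?A + ns i"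
      using dC' ks_pos[OF it] by linarith
    moreover have "sum ks (dead_blocks \<phi>) = sum ks (dead_blocks \<phi>') + ks i"
      "sum ns (dead_blocks \<phi>) = sum ns (dead_blocks \<phi>') + ns i"
      unfolding dead using fd i by (simp_all add: sum.remove)
    ultimately show ?thesis using IH by linarith
  qed
qed

text \<open>
  A functional vanishing on a \<open>k\<close>-dimensional block-bounded \<open>I'\<close> also vanishes on \<open>I' + SJ D\<close>, where \<open>D\<close> is
  its set of dead blocks; block-boundedness keeps \<open>I' \<inter> SJ D\<close> small, so the image is too small for
  \<open>functional_image_dim\<close>.
\<close>

lemma indep_if_block_bounded:
  assumes ev: "evasive emb (Lambda (k - 1) t ks) (k - 1) Ssum"
    and I: "F.subspace I" "I \<subseteq> Ssum" "block_bounded I"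
  shows "sys_rank I = int (F.dim I)"
proof -
  obtain I' where I': "F.subspace I'" "I \<subseteq> I'" "I' \<subseteq> Ssum" "block_bounded I'" "F.dim I' = k"
    using block_bounded_extend[OF I] by blast
  have sSS: "F.subspace Ssum" and fSS: "finite Ssum" and dSS: "F.dim Ssum = n"
    using SJ_subspace[of "{..<t}"] SJ_finite[of "{..<t}"] SJ_dim[of "{..<t}"] by auto
  have fI': "finite I'" using I'(3) fSS finite_subset by blast
  have sub: "K.span I' \<subseteq> vecs k"
    using I'(3) Ssum_vecs by (intro K.span_minimal vecs_subspace[OF vector_space_mult]) auto
  have "K.span I' = vecs k"
  proof (rule ccontr)
    assume "K.span I' \<noteq> vecs k"
    then obtain x where x: "x \<in> vecs k" "x \<notin> K.span I'" using sub by blast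
    obtain \<phi> where \<phi>: "Vector_Spaces.linear fscale (*) \<phi>" "\<And>u. u \<in> K.span I' \<Longrightarrow> \<phi> u = 0" "\<phi> x \<noteq> (0::'K)"
      using exists_functional[OF K.subspace_span x(2)] by blast
    interpret \<phi>: Vector_Spaces.linear fscale "(*)" \<phi> by (rule \<phi>(1))
    have F\<phi>: "Vector_Spaces.linear (escale emb) (emb_mult emb) \<phi>" by (rule F_linear_if_K_linear[OF \<phi>(1)])
    interpret F\<phi>: Vector_Spaces.linear "escale emb" "emb_mult emb" \<phi> by (rule F\<phi>)
    let ?D = "dead_blocks \<phi>"
    have D: "?D \<subseteq> {..<t}" by (auto simp: dead_blocks_def)
    let ?W = "{a + b |a b. a \<in> I' \<and> b \<in> SJ ?D}"
    have "\<phi> v = 0" if v: "v \<in> SJ ?D" for v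
    proof -
      obtain w where w: "v = (\<Sum>j\<in>?D. block_embed ks j (w j))" "\<forall>j\<in>?D. w j \<in> S j"
        using v by (auto simp: block_sum_def)
      have "\<phi> (block_embed ks j (w j)) = 0" if j: "j \<in> ?D" for j
        using j w(2) S_vecs[of j] by (auto simp: dead_blocks_def)
      then show ?thesis unfolding w(1) \<phi>.sum by (rule sum.neutral[OF ballI])
    qed
    moreover have "\<phi> v = 0" if "v \<in> I'" for v using \<phi>(2) K.span_superset[of I'] that by blast
    ultimately have "?W \<subseteq> {v \<in> Ssum. \<phi> v = 0}"
      using I'(3) SJ_Ssum[OF D] F.subspace_add[OF sSS] by (auto simp: \<phi>.add subset_iff)
    moreover have "F.subspace {v \<in> Ssum. \<phi> v = 0}"
      using F.subspace_inter[OF sSS F\<phi>.subspace_kernel] by (simp add: Int_def)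
    ultimately have "F.dim ?W \<le> F.dim {v \<in> Ssum. \<phi> v = 0}"
      using fSS by (intro F.dim_mono_subspace F.subspace_sums I' SJ_subspace[OF D]) auto
    moreover have "F.dim ?W + F.dim (I' \<inter> SJ ?D) = F.dim I' + F.dim (SJ ?D)"
      using fI' SJ_finite[OF D] by (intro F.dim_sum_Int I' SJ_subspace[OF D]) auto
    moreover have "F.dim (I' \<inter> SJ ?D) \<le> sum ks ?D" using I'(4) D by (auto simp: block_bounded_def)
    moreover have "n = F.dim {v \<in> Ssum. \<phi> v = 0} + FK.dim (\<phi> ` Ssum)"
      using dim_kernel_image[OF F\<phi> sSS fSS] unfolding dSS .
    moreover have "n + sum ks ?D < FK.dim (\<phi> ` Ssum) + k + sum ns ?D"
      using \<phi>(3) x(1) by (intro functional_image_dim[OF ev \<phi>(1)]) auto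
    ultimately show False using I'(5) SJ_dim[OF D] by linarith
  qed
  then have "sys_rank I' = int (F.dim I')" using I'(5) by (simp add: sys_rank_def dim_vecs del: K.dim_span)
  then show ?thesis
    by (rule F.qm_indep_subspace[OF q_matroid_Ssum fSS I(1) I'(1,2,3)])
qed

end

section \<open>Comparison with the direct sum of uniform \<open>q\<close>-matroids\<close>

lemma card_subspaces_transport:
  fixes s1 :: "'f::field \<Rightarrow> 'v::ab_group_add \<Rightarrow> 'v" and s2 :: "'f \<Rightarrow> 'w::ab_group_add \<Rightarrow> 'w"
  assumes f: "Vector_Spaces.linear s1 s2 f" and bij: "bij_betw f E1 E2"
    and E1: "module.subspace s1 E1"
    and PQ: "\<And>V. V \<in> subspaces_of s1 E1 \<Longrightarrow> P V \<longleftrightarrow> Q (f ` V)"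
  shows "card {V \<in> subspaces_of s1 E1. P V} = card {W \<in> subspaces_of s2 E2. Q W}"
proof -
  interpret f: Vector_Spaces.linear s1 s2 f by (rule f)
  have E2: "E2 = f ` E1" "inj_on f E1" using bij by (auto simp: bij_betw_def)
  have "bij_betw ((`) f) {V \<in> subspaces_of s1 E1. P V} {W \<in> subspaces_of s2 E2. Q W}"
    unfolding bij_betw_def
  proof
    show "inj_on ((`) f) {V \<in> subspaces_of s1 E1. P V}"
      using inj_on_image_Pow[OF E2(2)] by (rule inj_on_subset) (auto simp: subspaces_of_def)
    show "(`) f ` {V \<in> subspaces_of s1 E1. P V} = {W \<in> subspaces_of s2 E2. Q W}"
    proof (intro equalityI subsetI)
      fix W assume "W \<in> (`) f ` {V \<in> subspaces_of s1 E1. P V}"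
      then show "W \<in> {W \<in> subspaces_of s2 E2. Q W}"
        using PQ E2(1) f.subspace_image by (auto simp: subspaces_of_def)
    next
      fix W assume W: "W \<in> {W \<in> subspaces_of s2 E2. Q W}"
      let ?V = "E1 \<inter> f -` W"
      have eq: "f ` ?V = W" using W E2 by (auto simp: subspaces_of_def)
      have V: "?V \<in> subspaces_of s1 E1"
        using W f.vs1.subspace_inter[OF E1 f.subspace_vimage] by (auto simp: subspaces_of_def)
      have "P ?V" using PQ[OF V] W eq by simp
      then show "W \<in> (`) f ` {V \<in> subspaces_of s1 E1. P V}"
        using V eq by (intro image_eqI[of _ _ ?V]) auto
    qed
  qed
  then show ?thesis by (rule bij_betw_same_card)
qed

locale uniform_block_system = scalar_extension emb
  for emb :: "'f::{field,finite} \<Rightarrow> 'K::{field,finite}" +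
  fixes t :: nat and ks ns :: "nat \<Rightarrow> nat" and S :: "nat \<Rightarrow> (nat \<Rightarrow> 'K) set"
  assumes t_pos: "1 \<le> t"
    and uniform: "\<And>i. i < t \<Longrightarrow> represents emb (ns i) (ks i) (S i) fscale (uniform_qm (ks i) (ns i))"
    and pos: "\<And>i. i < t \<Longrightarrow> 1 \<le> ks i" and le: "\<And>i. i < t \<Longrightarrow> ks i \<le> ns i"
begin

sublocale block_system emb t ks ns S
  using uniform pos le by unfold_locales (auto simp: represents_def)

sublocale V: finite_scalars "fscale :: 'f \<Rightarrow> (nat \<Rightarrow> 'f) \<Rightarrow> (nat \<Rightarrow> 'f)"
  using vector_space_pointwise[OF vector_space_mult] by (simp add: finite_scalars_def)

sublocale P: finite_scalars "pointwise fscale :: 'f \<Rightarrow> (nat \<Rightarrow> nat \<Rightarrow> 'f) \<Rightarrow> (nat \<Rightarrow> nat \<Rightarrow> 'f)"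
  using vector_space_pointwise[OF V.vector_space_axioms] by (simp add: finite_scalars_def)

abbreviation U :: "nat \<Rightarrow> (nat \<Rightarrow> 'f) qmat" where "U \<equiv> \<lambda>i. uniform_qm (ks i) (ns i)"
definition Udsum :: "(nat \<Rightarrow> nat \<Rightarrow> 'f) qmat" where "Udsum = qm_dsums fscale U (t - 1)"

lemma U_iso:
  assumes "i < t"
  shows "\<exists>factor_iso. Vector_Spaces.linear fscale (escale emb) factor_iso \<and> bij_betw factor_iso (vecs (ns i) :: (nat \<Rightarrow> 'f) set) (S i)"
  using uniform[OF assms] by (auto simp: represents_def qm_equiv_def uniform_qm_def)

definition factor_iso :: "nat \<Rightarrow> (nat \<Rightarrow> 'f) \<Rightarrow> (nat \<Rightarrow> 'K)" where
  "factor_iso i = (SOME a. Vector_Spaces.linear fscale (escale emb) a \<and> bij_betw a (vecs (ns i)) (S i))"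

definition sum_iso :: "(nat \<Rightarrow> nat \<Rightarrow> 'f) \<Rightarrow> (nat \<Rightarrow> 'K)" where
  "sum_iso w = (\<Sum>i<t. block_embed ks i (factor_iso i (w i)))"

lemma factor_iso: "i < t \<Longrightarrow> Vector_Spaces.linear fscale (escale emb) (factor_iso i)"
  "i < t \<Longrightarrow> bij_betw (factor_iso i) (vecs (ns i)) (S i)"
  unfolding factor_iso_def using someI_ex[OF U_iso] by blast+

lemma q_matroid_U: "i < t \<Longrightarrow> q_matroid fscale (U i)"
  using uniform by (auto simp: represents_def qm_equiv_def)

lemma finite_U: "finite (fst (U i))"
  by (simp add: uniform_qm_def finite_vecs)

lemma Udsum_ground: "w \<in> fst Udsum \<longleftrightarrow> (\<forall>i<t. w i \<in> vecs (ns i)) \<and> (\<forall>i\<ge>t. w i = 0)"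
  using t_pos by (auto simp: Udsum_def qm_dsums_ground uniform_qm_def)

lemma linear_sum_iso: "Vector_Spaces.linear (pointwise fscale) (escale emb) sum_iso"
proof -
  interpret vector_space_pair "pointwise fscale :: 'f \<Rightarrow> (nat \<Rightarrow> nat \<Rightarrow> 'f) \<Rightarrow> _" "escale emb" ..
  have "Vector_Spaces.linear (pointwise fscale) (escale emb) (block_embed ks i \<circ> (factor_iso i \<circ> (\<lambda>w. w i)))"
    if "i < t" for i
    by (rule Vector_Spaces.linear_compose[OF Vector_Spaces.linear_compose[OF
          linear_component[OF V.vector_space_axioms] factor_iso(1)[OF that]] linear_block_embed[OF FK.vector_space_axioms]])
  then show ?thesis unfolding sum_iso_def[abs_def]
    by (intro linear_compose_sum) (auto simp: comp_def)
qed

lemma block_part_sum_iso: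
  assumes "w \<in> fst Udsum" "i < t"
  shows "block_part ks i (sum_iso w) = factor_iso i (w i)"
proof -
  have "factor_iso j (w j) \<in> vecs (ks j)" if "j \<in> {..<t}" for j
    using factor_iso(2)[of j] S_vecs[of j] assms(1) that by (auto simp: Udsum_ground bij_betw_def)
  then show ?thesis using assms(2) unfolding sum_iso_def by (subst block_part_sum) auto
qed

lemma bij_sum_iso: "bij_betw sum_iso (fst Udsum) Ssum"
  unfolding bij_betw_def
proof
  show "inj_on sum_iso (fst Udsum)"
  proof (rule inj_onI, rule ext)
    fix v w i assume v: "v \<in> fst Udsum" and w: "w \<in> fst Udsum" and e: "sum_iso v = sum_iso w"
    show "v i = w i"
    proof (cases "i < t")
      case True
      then have "factor_iso i (v i) = factor_iso i (w i)" using block_part_sum_iso v w e by metis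
      then show ?thesis using factor_iso(2)[OF True] v w True by (auto simp: Udsum_ground bij_betw_def inj_on_def)
    next
      case False
      then show ?thesis using v w by (auto simp: Udsum_ground)
    qed
  qed
  show "sum_iso ` fst Udsum = Ssum"
  proof (intro equalityI subsetI)
    fix x assume "x \<in> sum_iso ` fst Udsum"
    then obtain w where w: "x = sum_iso w" "w \<in> fst Udsum" by blast
    have "factor_iso i (w i) \<in> S i" if "i < t" for i
      using factor_iso(2)[OF that] w(2) that by (auto simp: Udsum_ground bij_betw_def)
    then show "x \<in> Ssum" unfolding block_sum_def w(1) sum_iso_def
      by (intro CollectI exI[of _ "\<lambda>i. factor_iso i (w i)"]) simp
  next
    fix x assume "x \<in> Ssum"
    then obtain v where x: "x = (\<Sum>j<t. block_embed ks j (v j))" and v: "\<forall>j\<in>{..<t}. v j \<in> S j"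
      by (auto simp: block_sum_def)
    define w where "w j = (if j < t then inv_into (vecs (ns j)) (factor_iso j) (v j) else 0)" for j
    have img: "v j \<in> factor_iso j ` vecs (ns j)" if "j < t" for j
      using factor_iso(2)[OF that] v that by (auto simp: bij_betw_def)
    have "w \<in> fst Udsum" using inv_into_into[OF img] by (auto simp: Udsum_ground w_def)
    moreover have "sum_iso w = x" unfolding sum_iso_def x
      by (intro sum.cong) (auto simp: w_def f_inv_into_f[OF img])
    ultimately show "x \<in> sum_iso ` fst Udsum" by blast
  qed
qed

lemma finite_Udsum: "finite (fst Udsum)"
  using bij_betw_finite[OF bij_sum_iso] SJ_finite[of "{..<t}"] by simp

lemma q_matroid_Udsum: "q_matroid (pointwise fscale) Udsum"
  and Udsum_subspace: "P.subspace (fst Udsum)"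
  using q_matroid_qm_dsums[OF V.vector_space_axioms _ _ finite_Udsum[unfolded Udsum_def]] q_matroid_U finite_U t_pos
  by (auto simp: Udsum_def)

text \<open>
  Through \<open>sum_iso\<close>, the sequences supported on \<open>J\<close> correspond to \<open>SJ J\<close>.
\<close>

lemma Udsum_indep_iff:
  assumes V: "P.subspace V" "V \<subseteq> fst Udsum"
  shows "snd Udsum V = int (P.dim V) \<longleftrightarrow> block_bounded (sum_iso ` V)"
proof -
  have fV: "finite V" using V(2) finite_Udsum finite_subset by blast
  have tt: "{..t - 1} = {..<t}" using t_pos by auto
  let ?Z = "\<lambda>J. {w. \<forall>i. i \<notin> J \<longrightarrow> w i = (0 :: nat \<Rightarrow> 'f)}"
  have Z: "P.subspace (?Z J)" for J by (rule P.subspaceI) (auto simp: pointwise_def fun_eq_iff)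
  have "snd Udsum V = P.free_rank (\<lambda>X. \<Sum>i\<le>t - 1. snd (U i) ((\<lambda>w. w i) ` X)) V"
    unfolding Udsum_def using q_matroid_U finite_U t_pos
    by (intro qm_dsums_rank[OF V.vector_space_axioms _ _ V(1) V(2)[unfolded Udsum_def] fV]) auto
  also have "\<dots> = P.free_rank (\<lambda>X. \<Sum>i\<in>{..<t}. int (min (ks i) (V.dim ((\<lambda>w. w i) ` X)))) V"
    unfolding tt by (simp add: uniform_qm_def)
  finally have "snd Udsum V = int (P.dim V) \<longleftrightarrow>
      (\<forall>J\<subseteq>{..<t}. P.dim (V \<inter> ?Z J) \<le> sum ks J)"
    using V Udsum_ground
    by (subst uniform_sum_indep_iff[OF V.vector_space_axioms V(1) fV, of "{..<t}" ks, symmetric]) auto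
  moreover have "P.dim (V \<inter> ?Z J) = F.dim (sum_iso ` V \<inter> SJ J)" if J: "J \<subseteq> {..<t}" for J
  proof -
    have z: "factor_iso i (w i) = 0 \<longleftrightarrow> w i = 0" if "w \<in> V" "i < t" for w i
    proof -
      interpret a: Vector_Spaces.linear fscale "escale emb" "factor_iso i" by (rule factor_iso(1)[OF that(2)])
      have "w i \<in> vecs (ns i)" "0 \<in> vecs (ns i)"
        using that V Udsum_ground[of w] by (auto simp: vecs_def)
      then show ?thesis
        using factor_iso(2)[OF that(2)] a.zero inj_onD[of "factor_iso i" "vecs (ns i)" "w i" 0] by (auto simp: bij_betw_def)
    qed
    have "sum_iso w \<in> SJ J \<longleftrightarrow> w \<in> ?Z J" if w: "w \<in> V" for w
    proof -
      have wE: "w \<in> fst Udsum" using w V by blast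
      have "sum_iso w \<in> Ssum" using bij_sum_iso wE by (auto simp: bij_betw_def)
      then have "sum_iso w \<in> SJ J \<longleftrightarrow> (\<forall>i\<in>{..<t} - J. w i = 0)"
        unfolding SJ_iff[OF J] using block_part_sum_iso[OF wE] z[OF w] by auto
      also have "\<dots> \<longleftrightarrow> w \<in> ?Z J" using wE Udsum_ground[of w]
        by auto (metis DiffI lessThan_iff not_le)
      finally show ?thesis .
    qed
    then have "sum_iso ` V \<inter> SJ J = sum_iso ` (V \<inter> ?Z J)" by auto
    moreover have "inj_on sum_iso (V \<inter> ?Z J)"
      using bij_sum_iso V(2) by (auto simp: bij_betw_def intro: inj_on_subset)
    ultimately show ?thesis
      using dim_image_inj_on[OF linear_sum_iso P.subspace_inter[OF V(1) Z]] fV by simp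
  qed
  ultimately show ?thesis by (simp add: block_bounded_def)
qed

text \<open>A given isomorphism and \<open>sum_iso\<close> show that \<open>Ssum\<close> has equally many independent and block-bounded
  subspaces; as the former are among the latter, the two families coincide although the isomorphism
  need not respect the blocks.\<close>

lemma represents_iff:
  "represents emb n k Ssum (pointwise fscale) Udsum \<longleftrightarrow>
    (\<forall>I. F.subspace I \<and> I \<subseteq> Ssum \<longrightarrow> (sys_rank I = int (F.dim I) \<longleftrightarrow> block_bounded I))"
    (is "_ \<longleftrightarrow> ?R")
proof
  assume "represents emb n k Ssum (pointwise fscale) Udsum"
  then obtain \<gamma> where \<gamma>: "Vector_Spaces.linear (pointwise fscale) (escale emb) \<gamma>" "bij_betw \<gamma> (fst Udsum) Ssum"
    and rank: "\<And>V. V \<in> subspaces_of (pointwise fscale) (fst Udsum) \<Longrightarrow> snd Udsum V = sys_rank (\<gamma> ` V)"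
    by (auto simp: represents_def qm_equiv_def)
  let ?A = "{I \<in> subspaces_of (escale emb) Ssum. sys_rank I = int (F.dim I)}"
  let ?B = "{I \<in> subspaces_of (escale emb) Ssum. block_bounded I}"
  have fin: "finite (subspaces_of (escale emb) Ssum)"
    by (rule F.finite_subspaces_of[OF SJ_finite]) simp
  have "card {V \<in> subspaces_of (pointwise fscale) (fst Udsum). snd Udsum V = int (P.dim V)} = card ?A"
  proof (rule card_subspaces_transport[OF \<gamma> Udsum_subspace])
    fix V assume V: "V \<in> subspaces_of (pointwise fscale) (fst Udsum)"
    then have V': "P.subspace V" "V \<subseteq> fst Udsum" by (auto simp: subspaces_of_def)
    have "F.dim (\<gamma> ` V) = P.dim V"
      using \<gamma>(2) V' finite_Udsum finite_subset
      by (intro dim_image_inj_on[OF \<gamma>(1) V'(1)]) (auto simp: bij_betw_def intro: inj_on_subset finite_subset)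
    then show "snd Udsum V = int (P.dim V) \<longleftrightarrow> sys_rank (\<gamma> ` V) = int (F.dim (\<gamma> ` V))"
      using rank[OF V] by simp
  qed
  moreover have "card {V \<in> subspaces_of (pointwise fscale) (fst Udsum). snd Udsum V = int (P.dim V)} = card ?B"
    by (rule card_subspaces_transport[OF linear_sum_iso bij_sum_iso Udsum_subspace])
      (auto simp: subspaces_of_def Udsum_indep_iff)
  moreover have AB: "?A \<subseteq> ?B" using block_bounded_if_indep by (auto simp: subspaces_of_def)
  ultimately have "?A = ?B" using fin by (intro card_subset_eq) auto
  then show ?R by (auto simp: subspaces_of_def)
next
  assume R: ?R
  have "snd Udsum V = sys_rank (sum_iso ` V)" if V: "P.subspace V" "V \<subseteq> fst Udsum" for V
  proof (rule rank_eq_if_same_indep[OF linear_sum_iso _ finite_Udsum q_matroid_Ssum bij_sum_iso _ V])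
    show "q_matroid (pointwise fscale) (fst Udsum, snd Udsum)" using q_matroid_Udsum by simp
    fix I assume I: "P.subspace I" "I \<subseteq> fst Udsum"
    interpret sum_iso: Vector_Spaces.linear "pointwise fscale" "escale emb" sum_iso by (rule linear_sum_iso)
    have "F.subspace (sum_iso ` I)" by (rule sum_iso.subspace_image[OF I(1)])
    moreover have "sum_iso ` I \<subseteq> Ssum" using bij_sum_iso I(2) by (auto simp: bij_betw_def)
    ultimately show "snd Udsum I = int (P.dim I) \<longleftrightarrow> sys_rank (sum_iso ` I) = int (F.dim (sum_iso ` I))"
      using R Udsum_indep_iff[OF I] by simp
  qed
  then show "represents emb n k Ssum (pointwise fscale) Udsum"
    unfolding represents_def qm_equiv_def
    using is_system_Ssum q_matroid_Udsum q_matroid_Ssum linear_sum_iso bij_sum_iso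
    by (auto simp: subspaces_of_def)
qed

lemma block_bounded_indep_iff_evasive:
  "(\<forall>I. F.subspace I \<and> I \<subseteq> Ssum \<longrightarrow> (sys_rank I = int (F.dim I) \<longleftrightarrow> block_bounded I)) \<longleftrightarrow>
    evasive emb (Lambda (k - 1) t ks) (k - 1) Ssum"
  using evasive_if_block_bounded_indep[OF _ _ t_pos] indep_if_block_bounded block_bounded_if_indep
  unfolding evasive_def by blast

end

theorem theorem2p4:
  fixes emb :: "'f::{field,finite} \<Rightarrow> 'K::{field,finite}"
    and q m t k n :: nat
    and ks ns :: "nat \<Rightarrow> nat"
    and S :: "nat \<Rightarrow> (nat \<Rightarrow> 'K) set"
    and SJ :: "nat set \<Rightarrow> (nat \<Rightarrow> 'K) set"
    and Ssum :: "(nat \<Rightarrow> 'K) set"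
  assumes "field_embedding emb"
    and "CARD('f) = q" and "CARD('K) = q ^ m" and "m \<ge> 1" and "t \<ge> 1"
    and "\<forall>i<t. 1 \<le> ks i \<and> ks i < ns i \<and> ns i \<le> m"
    and "k = (\<Sum>i<t. ks i)" and "n = (\<Sum>i<t. ns i)"
    and "\<forall>i<t. represents emb (ns i) (ks i) (S i) fscale (uniform_qm (ks i) (ns i))"
    and "\<And>J. SJ J = block_sum ks J S"
    and "Ssum = block_sum ks {..<t} S"
  defines "P1 \<equiv> represents emb n k Ssum (pointwise fscale)
                  (qm_dsums fscale (\<lambda>i. uniform_qm (ks i) (ns i)) (t - 1))"
    and "P2 \<equiv> (\<forall>I. module.subspace (escale emb) I \<and> I \<subseteq> Ssum \<longrightarrow>
                  (sys_rank I = int (vector_space.dim (escale emb) I) \<longleftrightarrow>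
                   (\<forall>J\<subseteq>{..<t}. vector_space.dim (escale emb) (I \<inter> SJ J) \<le> (\<Sum>j\<in>J. ks j))))"
    and "P3 \<equiv> evasive emb (Lambda (k - 1) t ks) (k - 1) Ssum"
  shows "(P1 \<longleftrightarrow> P2) \<and> (P2 \<longleftrightarrow> P3)"
proof -
  interpret uniform_block_system emb t ks ns S
    using assms(1,5,6,9) by unfold_locales auto
  have P2: "P2 \<longleftrightarrow> (\<forall>I. F.subspace I \<and> I \<subseteq> block_sum ks {..<t} S \<longrightarrow>
      (sys_rank I = int (F.dim I) \<longleftrightarrow> block_bounded I))"
    by (simp add: P2_def block_bounded_def assms(10,11))
  have "P1 \<longleftrightarrow> P2" unfolding P2 represents_iff[symmetric] by (simp add: P1_def Udsum_def assms(7,8,11))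
  moreover have "P2 \<longleftrightarrow> P3"
    unfolding P2 block_bounded_indep_iff_evasive by (simp add: P3_def assms(7,11))
  ultimately show ?thesis by blast
qed

end
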